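(* Let $m$ be a locally summable weight on a simplicial complex $\Sigma$ and, for $\circ\in\{+,-,H\}$, let $\Delta^\circ$ be a Laplacian. Then $D(\Delta^{+})\subseteq D(\partial\delta)$, $D(\Delta^{-})\subseteq D(\delta\partial)$, $D(\Delta^{H})\subseteq D((\delta+\partial)^2)$, and $$\Delta^+=\partial\delta\ \text{ on }D(\Delta^+),\qquad \Delta^-=\delta\partial\ \text{ on }D(\Delta^-),\qquad \Delta^H=(\delta+\partial)^2\ \text{ on }D(\Delta^H).$$ If $\Delta^H=\Delta^H_D$ or if $m$ is strongly locally summable, then $D(\Delta^H)\subseteq D(\partial\delta+\delta\partial)$ and $$\Delta^H=\partial\delta+\delta\partial\ \text{ on }D(\Delta^H).$$
   Context: Simplicial complex: $V$ is a countable set and $\hat\Sigma$ is a collection of finite subsets of $V$ closed under taking subsets. $\dim\tau=|\tau|-1$, $\hat\Sigma_k=\{\tau\in\hat\Sigma:\dim\tau=k\}$. A weight is a function $m:\hat\Sigma\to(0,\infty)$. Put $\Sigma=\hat\Sigma$ if $\sum_{v\in\hat\Sigma_0}m(v)<\infty$, and $\Sigma=\hat\Sigma\setminus\{\varnothing\}$ otherwise; $\Sigma_k=\hat\Sigma_k\cap\Sigma$. For $\tau,\sigma\in\Sigma$, $\tau\prec\sigma$ (equivalently $\sigma\succ\tau$) means $\tau\subset\sigma$ and $|\sigma\setminus\tau|=1$. All sums are over elements of $\Sigma$. The weight is locally summable if $\sum_{\sigma\succ\tau}m(\sigma)<\infty$ for all $\tau\in\Sigma$, and strongly locally summable if moreover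 $\sum_{\tau\succ\rho}\sum_{\sigma\succ\tau}m(\sigma)<\infty$ for all $\rho\in\Sigma$. Functions: $F=\mathbb{R}^{\Sigma}$; $F^c$ is the subspace of finitely supported functions; $F^1=\{\omega\in F:\sum_{\sigma\succ\tau}m(\sigma)|\omega(\sigma)|<\infty\text{ for all }\tau\in\Sigma\}$. Coboundary operator: a linear map $\delta:D(\delta)=F\to F$ with $\delta\delta=0$ such that $\theta(\tau,\sigma):=\delta 1_\tau(\sigma)\in\{-1,0,1\}$, $\theta(\tau,\sigma)\neq0$ iff $\tau\prec\sigma$, and $\delta\omega(\sigma)=\sum_{\tau\prec\sigma}\omega(\tau)\theta(\tau,\sigma)$. Boundary operator: $\partial:D(\partial)=F^1\to F$, $\partial\omega(\rho)=\frac1{m(\rho)}\sum_{\tau\succ\rho}m(\tau)\omega(\tau)\theta(\rho,\tau)$. Conventions: $D(A+B)=D(A)\cap D(B)$, $D(AB)=\{f\in D(B):Bf\in D(A)\}$. Forms and Laplacians: $\|\omega\|^2=\sum_\Sigma m\omega^2$, $\ell^2=\ell^2(\Sigma,m)=\{\omega\in F:\|\omega\|<\infty\}$ with its inner product. Put $\mathcal Q^+(\omega)=\|\delta\omega\|^2$ for $\omega\in F$, and $\mathcal Q^-(\omega)=\|\partial\omega\|^2$, $\mathcal Q^H(\omega)=\|\delta\omega+\partial\omega\|^2$ for $\omega\in F^1$, with values in $[0,\infty]$; $\mathcal D^\circ=\{\omega:\mathcal Q^\circ(\omega)<\infty\}$. $Q^\circ_N$ is the restriction of $\mathcal Q^\circ$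 to $D(Q^\circ_N)=\mathcal D^\circ\cap\ell^2$ (a closed form on $\ell^2$), and $Q^\circ_D$ its restriction to $D(Q_D^\circ)$, the closure of $F^c$ in $D(Q_N^\circ)$ with respect to $(\mathcal Q^\circ(\cdot)+\|\cdot\|^2)^{1/2}$. For forms, $Q\subseteq Q'$ means $D(Q)\subseteq D(Q')$ and $Q=Q'$ on $D(Q)$. A Laplacian $\Delta^\circ$ is the positive self-adjoint operator on $\ell^2$ associated to some closed form $Q^\circ$ with $Q^\circ_D\subseteq Q^\circ\subseteq Q^\circ_N$; $\Delta^\circ_D$, $\Delta^\circ_N$ are those associated with $Q_D^\circ$, $Q_N^\circ$. *)

theory Defs
  imports "HOL-Analysis.Analysis"
begin

section \<open>Weighted simplicial complexes\<close>

definition simplicial_complex :: "'v set \<Rightarrow> 'v set set \<Rightarrow> bool" where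
  "simplicial_complex V S \<longleftrightarrow>
     countable V \<and>
     (\<forall>\<tau>\<in>S. finite \<tau> \<and> \<tau> \<subseteq> V) \<and>
     (\<forall>\<tau>\<in>S. \<forall>\<rho>. \<rho> \<subseteq> \<tau> \<longrightarrow> \<rho> \<in> S)"

text \<open>The dimension is an integer, since the empty face has dimension -1.\<close>

definition face_dim :: "'v set \<Rightarrow> int" where
  "face_dim \<tau> = int (card \<tau>) - 1"

definition k_faces :: "'v set set \<Rightarrow> int \<Rightarrow> 'v set set" where
  "k_faces S k = {\<tau> \<in> S. face_dim \<tau> = k}"

definition weight :: "'v set set \<Rightarrow> ('v set \<Rightarrow> real) \<Rightarrow> bool" where
  "weight S m \<longleftrightarrow> (\<forall>\<tau>\<in>S. 0 < m \<tau>)"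

text \<open>From a complex \<open>S\<close> containing the empty face, \<open>active_faces S m\<close> keeps the empty face
  only if the vertices have finite total weight. Below, \<open>X\<close> always stands for this set, and
  all sums are over elements of \<open>X\<close>. For nonnegative reals \<open>summable_on\<close> means that the sum
  is finite.\<close>

definition active_faces :: "'v set set \<Rightarrow> ('v set \<Rightarrow> real) \<Rightarrow> 'v set set" where
  "active_faces S m = (if m summable_on k_faces S 0 then S else S - {{}})"

definition covered_by :: "'v set \<Rightarrow> 'v set \<Rightarrow> bool" (infix "\<prec>\<^sub>1" 50) where
  "\<tau> \<prec>\<^sub>1 \<sigma> \<longleftrightarrow> \<tau> \<subseteq> \<sigma> \<and> card (\<sigma> - \<tau>) = 1"

definition cofaces :: "'v set set \<Rightarrow> 'v set \<Rightarrow> 'v set set" where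
  "cofaces X \<tau> = {\<sigma> \<in> X. \<tau> \<prec>\<^sub>1 \<sigma>}"

definition locally_summable :: "'v set set \<Rightarrow> ('v set \<Rightarrow> real) \<Rightarrow> bool" where
  "locally_summable X m \<longleftrightarrow> (\<forall>\<tau>\<in>X. m summable_on cofaces X \<tau>)"

definition strongly_locally_summable :: "'v set set \<Rightarrow> ('v set \<Rightarrow> real) \<Rightarrow> bool" where
  "strongly_locally_summable X m \<longleftrightarrow>
     locally_summable X m \<and>
     (\<forall>\<rho>\<in>X. (\<lambda>\<tau>. \<Sum>\<^sub>\<infinity>\<sigma>\<in>cofaces X \<tau>. m \<sigma>) summable_on cofaces X \<rho>)"

section \<open>Function spaces\<close>

text \<open>A real function on \<open>X\<close> is encoded as a function on all sets vanishing outside \<open>X\<close>.\<close>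

type_synonym 'v cochain = "'v set \<Rightarrow> real"

definition cochains :: "'v set set \<Rightarrow> 'v cochain set" where
  "cochains X = {\<omega>. \<forall>\<sigma>. \<sigma> \<notin> X \<longrightarrow> \<omega> \<sigma> = 0}"

definition fin_cochains :: "'v set set \<Rightarrow> 'v cochain set" where
  "fin_cochains X = {\<omega> \<in> cochains X. finite {\<sigma>. \<omega> \<sigma> \<noteq> 0}}"

definition cochains1 :: "'v set set \<Rightarrow> ('v set \<Rightarrow> real) \<Rightarrow> 'v cochain set" where
  "cochains1 X m =
     {\<omega> \<in> cochains X. \<forall>\<tau>\<in>X. (\<lambda>\<sigma>. m \<sigma> * \<bar>\<omega> \<sigma>\<bar>) summable_on cofaces X \<tau>}"

definition sqnorm :: "'v set set \<Rightarrow> ('v set \<Rightarrow> real) \<Rightarrow> 'v cochain \<Rightarrow> ennreal" where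
  "sqnorm X m \<omega> = (\<Sum>\<^sub>\<infinity>\<sigma>\<in>X. ennreal (m \<sigma> * (\<omega> \<sigma>)\<^sup>2))"

definition l2 :: "'v set set \<Rightarrow> ('v set \<Rightarrow> real) \<Rightarrow> 'v cochain set" where
  "l2 X m = {\<omega> \<in> cochains X. sqnorm X m \<omega> < \<infinity>}"

definition l2_inner :: "'v set set \<Rightarrow> ('v set \<Rightarrow> real) \<Rightarrow> 'v cochain \<Rightarrow> 'v cochain \<Rightarrow> real" where
  "l2_inner X m \<omega> \<eta> = (\<Sum>\<^sub>\<infinity>\<sigma>\<in>X. m \<sigma> * \<omega> \<sigma> * \<eta> \<sigma>)"

section \<open>Coboundary and boundary operators\<close>

definition theta :: "('v cochain \<Rightarrow> 'v cochain) \<Rightarrow> 'v set \<Rightarrow> 'v set \<Rightarrow> real" where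
  "theta d \<tau> \<sigma> = d (indicator {\<tau>}) \<sigma>"

definition coboundary_map :: "'v set set \<Rightarrow> ('v cochain \<Rightarrow> 'v cochain) \<Rightarrow> bool" where
  "coboundary_map X d \<longleftrightarrow>
     (\<forall>\<omega>\<in>cochains X. d \<omega> \<in> cochains X) \<and>
     (\<forall>\<omega>\<in>cochains X. \<forall>\<eta>\<in>cochains X. \<forall>a b.
        d (\<lambda>\<sigma>. a * \<omega> \<sigma> + b * \<eta> \<sigma>) = (\<lambda>\<sigma>. a * d \<omega> \<sigma> + b * d \<eta> \<sigma>)) \<and>
     (\<forall>\<omega>\<in>cochains X. d (d \<omega>) = (\<lambda>\<sigma>. 0)) \<and>
     (\<forall>\<tau>\<in>X. \<forall>\<sigma>\<in>X. theta d \<tau> \<sigma> \<in> {-1, 0, 1} \<and> (theta d \<tau> \<sigma> \<noteq> 0 \<longleftrightarrow> \<tau> \<prec>\<^sub>1 \<sigma>)) \<and>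
     (\<forall>\<omega>\<in>cochains X. \<forall>\<sigma>\<in>X. d \<omega> \<sigma> = (\<Sum>\<tau> | \<tau> \<in> X \<and> \<tau> \<prec>\<^sub>1 \<sigma>. \<omega> \<tau> * theta d \<tau> \<sigma>))"

text \<open>Operators and forms with a domain are partial functions (maps). Thus \<open>\<subseteq>\<^sub>m\<close> is inclusion
  of operators or forms, and \<open>A \<circ>\<^sub>m B\<close> has the domain \<open>{\<omega> \<in> dom B. B \<omega> \<in> dom A}\<close>.\<close>

definition op_plus ::
    "('v cochain \<rightharpoonup> 'v cochain) \<Rightarrow> ('v cochain \<rightharpoonup> 'v cochain) \<Rightarrow> ('v cochain \<rightharpoonup> 'v cochain)"
    (infixl "\<oplus>\<^sub>m" 65) where
  "(A \<oplus>\<^sub>m B) \<omega> =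
     (if \<omega> \<in> dom A \<inter> dom B then Some (\<lambda>\<sigma>. the (A \<omega>) \<sigma> + the (B \<omega>) \<sigma>) else None)"

definition coboundary_op ::
    "'v set set \<Rightarrow> ('v cochain \<Rightarrow> 'v cochain) \<Rightarrow> ('v cochain \<rightharpoonup> 'v cochain)" where
  "coboundary_op X d = (\<lambda>\<omega>. Some (d \<omega>)) |` cochains X"

definition boundary_op ::
    "'v set set \<Rightarrow> ('v set \<Rightarrow> real) \<Rightarrow> ('v cochain \<Rightarrow> 'v cochain) \<Rightarrow> ('v cochain \<rightharpoonup> 'v cochain)"
  where
  "boundary_op X m d =
     (\<lambda>\<omega>. Some (\<lambda>\<rho>. if \<rho> \<in> X
                    then 1 / m \<rho> * (\<Sum>\<^sub>\<infinity>\<tau>\<in>cofaces X \<rho>. m \<tau> * \<omega> \<tau> * theta d \<rho> \<tau>)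
                    else 0)) |` cochains1 X m"

section \<open>Forms\<close>

text \<open>\<open>ext_form X m A\<close> is the form \<open>\<omega> \<mapsto> \<parallel>A \<omega>\<parallel>\<^sup>2\<close> with values in \<open>[0,\<infinity>]\<close>, defined on the domain
  of \<open>A\<close>. The three forms are obtained by taking for \<open>A\<close> the coboundary operator, the boundary
  operator, and their sum (which has domain \<open>cochains1 X m\<close>).\<close>

definition ext_form ::
    "'v set set \<Rightarrow> ('v set \<Rightarrow> real) \<Rightarrow> ('v cochain \<rightharpoonup> 'v cochain) \<Rightarrow> ('v cochain \<rightharpoonup> ennreal)" where
  "ext_form X m A = map_option (sqnorm X m) \<circ> A"

definition finite_domain :: "('v cochain \<rightharpoonup> ennreal) \<Rightarrow> 'v cochain set" where
  "finite_domain E = {\<omega> \<in> dom E. the (E \<omega>) < \<infinity>}"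

definition form_N ::
    "'v set set \<Rightarrow> ('v set \<Rightarrow> real) \<Rightarrow> ('v cochain \<rightharpoonup> 'v cochain) \<Rightarrow> ('v cochain \<rightharpoonup> real)" where
  "form_N X m A =
     (map_option enn2real \<circ> ext_form X m A) |` (finite_domain (ext_form X m A) \<inter> l2 X m)"

definition form_norm ::
    "'v set set \<Rightarrow> ('v set \<Rightarrow> real) \<Rightarrow> ('v cochain \<rightharpoonup> real) \<Rightarrow> 'v cochain \<Rightarrow> real" where
  "form_norm X m q \<omega> = sqrt (the (q \<omega>) + enn2real (sqnorm X m \<omega>))"

definition form_D ::
    "'v set set \<Rightarrow> ('v set \<Rightarrow> real) \<Rightarrow> ('v cochain \<rightharpoonup> 'v cochain) \<Rightarrow> ('v cochain \<rightharpoonup> real)" where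
  "form_D X m A = form_N X m A |`
     {\<omega> \<in> dom (form_N X m A).
        \<exists>\<phi>. (\<forall>n::nat. \<phi> n \<in> fin_cochains X) \<and>
            (\<lambda>n. form_norm X m (form_N X m A) (\<lambda>\<sigma>. \<phi> n \<sigma> - \<omega> \<sigma>)) \<longlonglongrightarrow> 0}"

definition positive_form ::
    "'v set set \<Rightarrow> ('v set \<Rightarrow> real) \<Rightarrow> ('v cochain \<rightharpoonup> real) \<Rightarrow> bool" where
  "positive_form X m q \<longleftrightarrow>
     dom q \<subseteq> l2 X m \<and>
     (\<lambda>\<sigma>. 0) \<in> dom q \<and>
     (\<forall>\<omega>\<in>dom q. \<forall>\<eta>\<in>dom q. \<forall>a b. (\<lambda>\<sigma>. a * \<omega> \<sigma> + b * \<eta> \<sigma>) \<in> dom q) \<and>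
     (\<forall>\<omega>\<in>dom q. 0 \<le> the (q \<omega>)) \<and>
     (\<exists>B. (\<forall>\<omega>\<in>dom q. \<forall>\<eta>\<in>dom q. B \<omega> \<eta> = B \<eta> \<omega>) \<and>
          (\<forall>\<omega>\<in>dom q. \<forall>\<eta>\<in>dom q. \<forall>\<psi>\<in>dom q. \<forall>a b.
             B (\<lambda>\<sigma>. a * \<omega> \<sigma> + b * \<eta> \<sigma>) \<psi> = a * B \<omega> \<psi> + b * B \<eta> \<psi>) \<and>
          (\<forall>\<omega>\<in>dom q. q \<omega> = Some (B \<omega> \<omega>)))"

definition closed_form ::
    "'v set set \<Rightarrow> ('v set \<Rightarrow> real) \<Rightarrow> ('v cochain \<rightharpoonup> real) \<Rightarrow> bool" where
  "closed_form X m q \<longleftrightarrow>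
     positive_form X m q \<and>
     (\<forall>\<phi>. (\<forall>n::nat. \<phi> n \<in> dom q) \<and>
          (\<forall>e>0. \<exists>N. \<forall>i\<ge>N. \<forall>j\<ge>N. form_norm X m q (\<lambda>\<sigma>. \<phi> i \<sigma> - \<phi> j \<sigma>) < e) \<longrightarrow>
          (\<exists>\<omega>\<in>dom q. (\<lambda>n. form_norm X m q (\<lambda>\<sigma>. \<phi> n \<sigma> - \<omega> \<sigma>)) \<longlonglongrightarrow> 0))"

section \<open>Operators associated with forms\<close>

definition polar :: "('v cochain \<rightharpoonup> real) \<Rightarrow> 'v cochain \<Rightarrow> 'v cochain \<Rightarrow> real" where
  "polar q \<omega> \<eta> = (the (q (\<lambda>\<sigma>. \<omega> \<sigma> + \<eta> \<sigma>)) - the (q (\<lambda>\<sigma>. \<omega> \<sigma> - \<eta> \<sigma>))) / 4"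

text \<open>For a densely defined closed positive form \<open>q\<close>, the operator associated with \<open>q\<close> (which is
  then positive and self-adjoint) sends \<open>\<omega> \<in> dom q\<close> to the \<open>\<eta> \<in> l2 X m\<close> with
  \<open>polar q \<omega> \<psi> = l2_inner X m \<eta> \<psi>\<close> for all \<open>\<psi> \<in> dom q\<close>, and its domain is the set of those \<open>\<omega>\<close>
  for which such an \<open>\<eta>\<close> exists. It is unique because \<open>dom q\<close> is dense. This applies to all the
  forms between \<open>form_D X m A\<close> and \<open>form_N X m A\<close>, whose domains contain \<open>fin_cochains X\<close> if the
  weight is locally summable.\<close>

definition represents ::
    "'v set set \<Rightarrow> ('v set \<Rightarrow> real) \<Rightarrow> ('v cochain \<rightharpoonup> real) \<Rightarrow> 'v cochain \<Rightarrow> 'v cochain \<Rightarrow> bool" where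
  "represents X m q \<omega> \<eta> \<longleftrightarrow>
     \<eta> \<in> l2 X m \<and> (\<forall>\<psi>\<in>dom q. polar q \<omega> \<psi> = l2_inner X m \<eta> \<psi>)"

definition form_operator ::
    "'v set set \<Rightarrow> ('v set \<Rightarrow> real) \<Rightarrow> ('v cochain \<rightharpoonup> real) \<Rightarrow> ('v cochain \<rightharpoonup> 'v cochain)" where
  "form_operator X m q =
     (\<lambda>\<omega>. Some (THE \<eta>. represents X m q \<omega> \<eta>)) |` {\<omega> \<in> dom q. \<exists>\<eta>. represents X m q \<omega> \<eta>}"

definition laplacian ::
    "'v set set \<Rightarrow> ('v set \<Rightarrow> real) \<Rightarrow> ('v cochain \<rightharpoonup> 'v cochain) \<Rightarrow> ('v cochain \<rightharpoonup> 'v cochain) \<Rightarrow> bool"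
  where
  "laplacian X m A L \<longleftrightarrow>
     (\<exists>q. closed_form X m q \<and> form_D X m A \<subseteq>\<^sub>m q \<and> q \<subseteq>\<^sub>m form_N X m A \<and>
          L = form_operator X m q)"

definition laplacian_D ::
    "'v set set \<Rightarrow> ('v set \<Rightarrow> real) \<Rightarrow> ('v cochain \<rightharpoonup> 'v cochain) \<Rightarrow> ('v cochain \<rightharpoonup> 'v cochain)" where
  "laplacian_D X m A = form_operator X m (form_D X m A)"

end

theory Submission
  imports Defs
begin

text \<open>
  Let \<open>A\<close> be one of \<open>\<delta>\<close>, \<open>\<partial>\<close>, \<open>\<delta> + \<partial>\<close>. Every form between the Dirichlet and the Neumann form has
  all indicators \<open>1\<^sub>\<rho>\<close> in its domain, so its operator \<open>L\<close> satisfies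
  \<open>m(\<rho>) L\<omega>(\<rho>) = \<langle>A\<omega>, A1\<^sub>\<rho>\<rangle>\<close>. Since \<open>\<langle>f, \<delta>1\<^sub>\<rho>\<rangle> = m(\<rho>) \<partial>f(\<rho>)\<close> and \<open>\<langle>f, \<partial>1\<^sub>\<rho>\<rangle> = m(\<rho>) \<delta>f(\<rho>)\<close>,
  and since local summability puts \<open>A\<omega> \<in> \<ell>\<^sup>2\<close> into the domain of \<open>\<partial>\<close>, this computes \<open>L\<omega>\<close>.
  Splitting \<open>(\<delta> + \<partial>)\<^sup>2\<close> requires \<open>\<partial>(\<delta> + \<partial>)\<omega> = \<partial>\<delta>\<omega>\<close>. Under strong local summability,
  \<open>\<partial>\<partial> = 0\<close> on \<open>\<ell>\<^sup>2\<close> by Fubini. In the Dirichlet case, \<open>\<delta>\<phi> \<bottom> \<partial>\<psi>\<close> for finitely supported \<open>\<phi>\<close>, \<open>\<psi>\<close>,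
  whence \<open>\<parallel>\<delta>\<phi>\<parallel> \<le> \<parallel>(\<delta> + \<partial>)\<phi>\<parallel>\<close>; by Fatou a similar bound survives in the form closure, so \<open>\<delta>\<close> is
  continuous in the form norm and
  \<open>\<langle>(\<delta> + \<partial>)\<omega>, \<delta>1\<^sub>\<rho>\<rangle> = \<langle>\<delta>\<omega>, \<delta>1\<^sub>\<rho>\<rangle>\<close> passes to the limit.
\<close>

section \<open>The weighted Hilbert space\<close>

lemma ennreal_infsum:
  fixes f :: "'a \<Rightarrow> real"
  assumes "\<And>x. x \<in> A \<Longrightarrow> 0 \<le> f x" "f summable_on A"
  shows "(\<Sum>\<^sub>\<infinity>x\<in>A. ennreal (f x)) = ennreal (infsum f A)"
proof -
  have "infsum (ennreal \<circ> f) A = ennreal (infsum f A)"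
  proof (rule infsum_comm_additive_general)
    fix F assume "finite F" "F \<subseteq> A"
    then show "sum (ennreal \<circ> f) F = ennreal (sum f F)"
      using assms(1) by (subst sum_ennreal[symmetric]) (auto simp: subset_iff)
  qed (use assms in auto)
  then show ?thesis by (simp add: o_def)
qed

text \<open>Finite partial sums are dominated by the \<open>ennreal\<close> total, so a finite total
  bounds them. This turns finiteness of \<open>sqnorm\<close> into real summability, and later
  estimates can stay in the reals.\<close>

lemma ennreal_infsum_finite_iff:
  fixes f :: "'a \<Rightarrow> real"
  assumes "\<And>x. x \<in> A \<Longrightarrow> 0 \<le> f x"
  shows "(\<Sum>\<^sub>\<infinity>x\<in>A. ennreal (f x)) < \<infinity> \<longleftrightarrow> f summable_on A"
proof
  assume fin: "(\<Sum>\<^sub>\<infinity>x\<in>A. ennreal (f x)) < \<infinity>"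
  show "f summable_on A"
  proof (rule nonneg_bdd_above_summable_on[OF assms])
    show "bdd_above (sum f ` {F. F \<subseteq> A \<and> finite F})"
    proof (rule bdd_aboveI2)
      fix F assume F: "F \<in> {F. F \<subseteq> A \<and> finite F}"
      have "ennreal (sum f F) = (\<Sum>x\<in>F. ennreal (f x))"
        using F assms by (subst sum_ennreal) auto
      also have "\<dots> = (\<Sum>\<^sub>\<infinity>x\<in>F. ennreal (f x))" using F by simp
      also have "\<dots> \<le> (\<Sum>\<^sub>\<infinity>x\<in>A. ennreal (f x))"
        by (rule infsum_mono_neutral) (use F in \<open>auto intro: nonneg_summable_on_complete\<close>)
      finally have "enn2real (ennreal (sum f F)) \<le> enn2real (\<Sum>\<^sub>\<infinity>x\<in>A. ennreal (f x))"
        using fin by (intro enn2real_mono) auto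
      moreover have "0 \<le> sum f F" using F assms by (auto intro: sum_nonneg)
      ultimately show "sum f F \<le> enn2real (\<Sum>\<^sub>\<infinity>x\<in>A. ennreal (f x))" by simp
    qed
  qed
next
  assume "f summable_on A"
  then show "(\<Sum>\<^sub>\<infinity>x\<in>A. ennreal (f x)) < \<infinity>" using assms by (simp add: ennreal_infsum)
qed

lemma summable_on_real_comparison:
  fixes f g :: "'a \<Rightarrow> real"
  assumes "g summable_on A" "\<And>x. x \<in> A \<Longrightarrow> \<bar>f x\<bar> \<le> g x"
  shows "f summable_on A"
proof (rule abs_summable_summable)
  show "(\<lambda>x. norm (f x)) summable_on A"
    by (rule summable_on_comparison_test[OF assms(1)]) (use assms(2) in auto)
qed

section \<open>Squared norm and inner product of the weighted l2 space\<close>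

locale weighted_complex =
  fixes X :: "'v set set" and m :: "'v set \<Rightarrow> real" and d :: "'v cochain \<Rightarrow> 'v cochain"
  assumes face_finite: "\<tau> \<in> X \<Longrightarrow> finite \<tau>"
    and m_pos: "\<tau> \<in> X \<Longrightarrow> 0 < m \<tau>"
    and loc_summable: "locally_summable X m"
    and coboundary: "coboundary_map X d"
begin

text \<open>Real-valued counterpart of \<open>sqnorm\<close>. Where the series diverges
  \<open>infsum\<close> returns 0, so the value is trusted as a squared norm only together with
  membership in \<open>l2 X m\<close>.\<close>

definition nsq :: "'v cochain \<Rightarrow> real" where
  "nsq \<omega> = (\<Sum>\<^sub>\<infinity>\<sigma>\<in>X. m \<sigma> * (\<omega> \<sigma>)\<^sup>2)"

abbreviation "ip \<equiv> l2_inner X m"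

lemma m_nonneg: "\<tau> \<in> X \<Longrightarrow> 0 \<le> m \<tau>"
  using m_pos by (simp add: less_imp_le)

lemma l2_iff: "\<omega> \<in> l2 X m \<longleftrightarrow> \<omega> \<in> cochains X \<and> (\<lambda>\<sigma>. m \<sigma> * (\<omega> \<sigma>)\<^sup>2) summable_on X"
proof -
  have "sqnorm X m \<omega> < \<infinity> \<longleftrightarrow> (\<lambda>\<sigma>. m \<sigma> * (\<omega> \<sigma>)\<^sup>2) summable_on X"
    unfolding sqnorm_def
    by (rule ennreal_infsum_finite_iff) (simp add: m_nonneg)
  then show ?thesis by (simp add: l2_def)
qed

lemma nsq_nonneg: "0 \<le> nsq \<omega>"
  unfolding nsq_def using m_nonneg by (intro infsum_nonneg) auto

lemma sqnorm_l2:
  assumes "\<omega> \<in> l2 X m"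
  shows "enn2real (sqnorm X m \<omega>) = nsq \<omega>"
proof -
  have "sqnorm X m \<omega> = ennreal (nsq \<omega>)"
    unfolding sqnorm_def nsq_def
    by (rule ennreal_infsum) (use assms m_nonneg in \<open>auto simp: l2_iff\<close>)
  then show ?thesis by (simp add: nsq_nonneg)
qed

lemma cochains_lin:
  "\<omega> \<in> cochains X \<Longrightarrow> \<eta> \<in> cochains X \<Longrightarrow> (\<lambda>\<sigma>. a * \<omega> \<sigma> + b * \<eta> \<sigma>) \<in> cochains X"
  unfolding cochains_def by auto

lemma l2_mult_summable:
  assumes "f \<in> l2 X m" "g \<in> l2 X m"
  shows "(\<lambda>\<sigma>. m \<sigma> * f \<sigma> * g \<sigma>) summable_on X"
proof (rule summable_on_real_comparison)
  show "(\<lambda>\<sigma>. m \<sigma> * (f \<sigma>)\<^sup>2 + m \<sigma> * (g \<sigma>)\<^sup>2) summable_on X"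
    using assms by (intro summable_on_add) (auto simp: l2_iff)
  fix \<sigma> assume "\<sigma> \<in> X"
  then have "0 < m \<sigma>" by (rule m_pos)
  have "\<bar>f \<sigma>\<bar> * \<bar>g \<sigma>\<bar> \<le> (f \<sigma>)\<^sup>2 + (g \<sigma>)\<^sup>2"
    using sum_squares_bound[of "\<bar>f \<sigma>\<bar>" "\<bar>g \<sigma>\<bar>"] mult_nonneg_nonneg[of "\<bar>f \<sigma>\<bar>" "\<bar>g \<sigma>\<bar>"]
    unfolding power2_abs by linarith
  then have "m \<sigma> * (\<bar>f \<sigma>\<bar> * \<bar>g \<sigma>\<bar>) \<le> m \<sigma> * ((f \<sigma>)\<^sup>2 + (g \<sigma>)\<^sup>2)"
    using \<open>0 < m \<sigma>\<close> by (intro mult_left_mono) auto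
  then show "\<bar>m \<sigma> * f \<sigma> * g \<sigma>\<bar> \<le> m \<sigma> * (f \<sigma>)\<^sup>2 + m \<sigma> * (g \<sigma>)\<^sup>2"
    using \<open>0 < m \<sigma>\<close> by (simp add: abs_mult algebra_simps)
qed

lemma nsq_eq_ip: "nsq f = ip f f"
  by (simp add: nsq_def l2_inner_def power2_eq_square mult.assoc)

lemma l2_lin:
  assumes "f \<in> l2 X m" "g \<in> l2 X m"
  shows "(\<lambda>\<sigma>. a * f \<sigma> + b * g \<sigma>) \<in> l2 X m"
proof -
  have "(\<lambda>\<sigma>. a\<^sup>2 * (m \<sigma> * (f \<sigma>)\<^sup>2) + (b\<^sup>2 * (m \<sigma> * (g \<sigma>)\<^sup>2) + 2 * a * b * (m \<sigma> * f \<sigma> * g \<sigma>)))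
      summable_on X"
    using assms by (intro summable_on_add summable_on_cmult_right l2_mult_summable)
      (auto simp: l2_iff)
  moreover have "m \<sigma> * (a * f \<sigma> + b * g \<sigma>)\<^sup>2
     = a\<^sup>2 * (m \<sigma> * (f \<sigma>)\<^sup>2) + (b\<^sup>2 * (m \<sigma> * (g \<sigma>)\<^sup>2) + 2 * a * b * (m \<sigma> * f \<sigma> * g \<sigma>))" for \<sigma>
    by (simp add: power2_eq_square algebra_simps)
  ultimately show ?thesis using assms by (auto simp: l2_iff cochains_lin)
qed

lemma l2_zero: "(\<lambda>\<sigma>. 0) \<in> l2 X m"
  by (auto simp: l2_iff cochains_def)

lemma ip_commute: "ip f g = ip g f"
  by (simp add: l2_inner_def mult_ac)

lemma ip_lin_left:
  assumes "f \<in> l2 X m" "g \<in> l2 X m" "h \<in> l2 X m"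
  shows "ip (\<lambda>\<sigma>. a * f \<sigma> + b * g \<sigma>) h = a * ip f h + b * ip g h"
proof -
  have "ip (\<lambda>\<sigma>. a * f \<sigma> + b * g \<sigma>) h
      = (\<Sum>\<^sub>\<infinity>\<sigma>\<in>X. a * (m \<sigma> * f \<sigma> * h \<sigma>) + b * (m \<sigma> * g \<sigma> * h \<sigma>))"
    unfolding l2_inner_def by (simp add: algebra_simps)
  also have "\<dots> = a * ip f h + b * ip g h"
    unfolding l2_inner_def using assms
    by (subst infsum_add) (auto intro!: summable_on_cmult_right l2_mult_summable
        simp: infsum_cmult_right')
  finally show ?thesis .
qed

lemma ip_lin_right:
  assumes "f \<in> l2 X m" "g \<in> l2 X m" "h \<in> l2 X m"
  shows "ip h (\<lambda>\<sigma>. a * f \<sigma> + b * g \<sigma>) = a * ip h f + b * ip h g"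
  using ip_lin_left[OF assms] by (simp add: ip_commute)

lemma nsq_lin:
  assumes "f \<in> l2 X m" "g \<in> l2 X m"
  shows "nsq (\<lambda>\<sigma>. a * f \<sigma> + b * g \<sigma>) = a\<^sup>2 * nsq f + 2 * a * b * ip f g + b\<^sup>2 * nsq g"
  unfolding nsq_eq_ip using assms
  by (simp add: ip_lin_left ip_lin_right l2_lin ip_commute[of g f] power2_eq_square algebra_simps)

lemma nsq_lin_le:
  assumes "f \<in> l2 X m" "g \<in> l2 X m"
  shows "nsq (\<lambda>\<sigma>. f \<sigma> + g \<sigma>) \<le> 2 * nsq f + 2 * nsq g"
  using nsq_lin[OF assms, of 1 1] nsq_lin[OF assms, of 1 "-1"]
    nsq_nonneg[of "\<lambda>\<sigma>. 1 * f \<sigma> + -1 * g \<sigma>"] by simp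

section \<open>Cauchy-Schwarz, norm limits and lower semicontinuity\<close>

lemma ip_Cauchy_Schwarz:
  assumes "f \<in> l2 X m" "g \<in> l2 X m"
  shows "(ip f g)\<^sup>2 \<le> nsq f * nsq g"
proof (rule tendsto_le)
  show "finite_subsets_at_top X \<noteq> bot" by simp
  show "((\<lambda>F. (\<Sum>\<sigma>\<in>F. m \<sigma> * f \<sigma> * g \<sigma>)\<^sup>2) \<longlongrightarrow> (ip f g)\<^sup>2) (finite_subsets_at_top X)"
    unfolding l2_inner_def using l2_mult_summable[OF assms]
    by (intro tendsto_power infsum_tendsto)
  show "((\<lambda>F. (\<Sum>\<sigma>\<in>F. m \<sigma> * (f \<sigma>)\<^sup>2) * (\<Sum>\<sigma>\<in>F. m \<sigma> * (g \<sigma>)\<^sup>2)) \<longlongrightarrow> nsq f * nsq g)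
      (finite_subsets_at_top X)"
    unfolding nsq_def using assms
    by (intro tendsto_mult infsum_tendsto) (auto simp: l2_iff)
  show "\<forall>\<^sub>F F in finite_subsets_at_top X.
      (\<Sum>\<sigma>\<in>F. m \<sigma> * f \<sigma> * g \<sigma>)\<^sup>2 \<le> (\<Sum>\<sigma>\<in>F. m \<sigma> * (f \<sigma>)\<^sup>2) * (\<Sum>\<sigma>\<in>F. m \<sigma> * (g \<sigma>)\<^sup>2)"
  proof (rule eventually_finite_subsets_at_top_weakI)
    fix F assume F: "finite F" "F \<subseteq> X"
    \<comment> \<open>Splitting the weight into two square roots reduces the weighted inequality on
      a finite set to the unweighted one; the infinite sums are limits along finite subsets.\<close>
    have *: "sqrt (m \<sigma>) * sqrt (m \<sigma>) = m \<sigma>" if "\<sigma> \<in> F" for \<sigma>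
      using m_pos[of \<sigma>] F that by auto
    have "(\<Sum>\<sigma>\<in>F. (sqrt (m \<sigma>) * f \<sigma>) * (sqrt (m \<sigma>) * g \<sigma>))\<^sup>2
        \<le> (\<Sum>\<sigma>\<in>F. (sqrt (m \<sigma>) * f \<sigma>)\<^sup>2) * (\<Sum>\<sigma>\<in>F. (sqrt (m \<sigma>) * g \<sigma>)\<^sup>2)"
      by (rule Cauchy_Schwarz_ineq_sum)
    moreover have "(\<Sum>\<sigma>\<in>F. (sqrt (m \<sigma>) * f \<sigma>) * (sqrt (m \<sigma>) * g \<sigma>)) = (\<Sum>\<sigma>\<in>F. m \<sigma> * f \<sigma> * g \<sigma>)"
    proof (rule sum.cong)
      fix \<sigma> assume "\<sigma> \<in> F"
      have "(sqrt (m \<sigma>) * f \<sigma>) * (sqrt (m \<sigma>) * g \<sigma>) = (sqrt (m \<sigma>) * sqrt (m \<sigma>)) * f \<sigma> * g \<sigma>"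
        by (simp only: mult_ac)
      then show "(sqrt (m \<sigma>) * f \<sigma>) * (sqrt (m \<sigma>) * g \<sigma>) = m \<sigma> * f \<sigma> * g \<sigma>"
        using *[OF \<open>\<sigma> \<in> F\<close>] by simp
    qed simp
    moreover have "(\<Sum>\<sigma>\<in>F. (sqrt (m \<sigma>) * h \<sigma>)\<^sup>2) = (\<Sum>\<sigma>\<in>F. m \<sigma> * (h \<sigma>)\<^sup>2)" for h
      by (rule sum.cong) (use F m_nonneg in \<open>auto simp: power_mult_distrib subset_iff\<close>)
    ultimately show "(\<Sum>\<sigma>\<in>F. m \<sigma> * f \<sigma> * g \<sigma>)\<^sup>2
        \<le> (\<Sum>\<sigma>\<in>F. m \<sigma> * (f \<sigma>)\<^sup>2) * (\<Sum>\<sigma>\<in>F. m \<sigma> * (g \<sigma>)\<^sup>2)" by simp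
  qed
qed

lemma ip_tendsto_zero:
  assumes "\<And>n. f n \<in> l2 X m" "g \<in> l2 X m" "(\<lambda>n. nsq (f n)) \<longlonglongrightarrow> 0"
  shows "(\<lambda>n. ip (f n) g) \<longlonglongrightarrow> 0"
proof -
  have "(\<lambda>n. (ip (f n) g)\<^sup>2) \<longlonglongrightarrow> 0"
  proof (rule tendsto_sandwich[where f = "\<lambda>_. 0"])
    show "(\<lambda>n. nsq (f n) * nsq g) \<longlonglongrightarrow> 0"
      using tendsto_mult_left_zero[OF assms(3)] .
    show "\<forall>\<^sub>F n in sequentially. (ip (f n) g)\<^sup>2 \<le> nsq (f n) * nsq g"
      using ip_Cauchy_Schwarz[OF assms(1,2)] by (intro always_eventually allI)
  qed auto
  then show ?thesis by (simp add: power_tendsto_0_iff)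
qed

lemma nsq_ge_point:
  assumes "f \<in> l2 X m" "\<sigma> \<in> X"
  shows "m \<sigma> * (f \<sigma>)\<^sup>2 \<le> nsq f"
proof -
  have "(\<Sum>\<tau>\<in>{\<sigma>}. m \<tau> * (f \<tau>)\<^sup>2) \<le> nsq f"
    unfolding nsq_def using assms m_nonneg
    by (intro finite_sum_le_infsum) (auto simp: l2_iff)
  then show ?thesis by simp
qed

text \<open>Each face has positive mass, so the norm controls the value at that face.\<close>

lemma nsq_tendsto_zero_pointwise:
  assumes "\<And>n. f n \<in> l2 X m" "(\<lambda>n. nsq (f n)) \<longlonglongrightarrow> 0" "\<sigma> \<in> X"
  shows "(\<lambda>n. f n \<sigma>) \<longlonglongrightarrow> 0"
proof -
  have "(\<lambda>n. (f n \<sigma>)\<^sup>2) \<longlonglongrightarrow> 0"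
  proof (rule tendsto_sandwich[where f = "\<lambda>_. 0"])
    show "(\<lambda>n. nsq (f n) / m \<sigma>) \<longlonglongrightarrow> 0"
      using tendsto_divide_zero[OF assms(2)] .
    show "\<forall>\<^sub>F n in sequentially. (f n \<sigma>)\<^sup>2 \<le> nsq (f n) / m \<sigma>"
      using nsq_ge_point[OF assms(1,3)] m_pos[OF assms(3)]
      by (intro always_eventually allI) (simp add: pos_le_divide_eq mult.commute)
  qed auto
  then show ?thesis by (simp add: power_tendsto_0_iff)
qed

text \<open>A finite partial sum passes to the pointwise limit and stays below \<open>C\<close>; the
  supremum over finite sets then does too. The bounds \<open>c n\<close> vary with \<open>n\<close>
  because the application only has a bound with an error term tending to 0.\<close>

lemma l2_Fatou:
  assumes "\<And>n. f n \<in> l2 X m" "g \<in> cochains X" "\<And>\<sigma>. \<sigma> \<in> X \<Longrightarrow> (\<lambda>n. f n \<sigma>) \<longlonglongrightarrow> g \<sigma>"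
    and "\<And>n. nsq (f n) \<le> c n" "c \<longlonglongrightarrow> C"
  shows "g \<in> l2 X m \<and> nsq g \<le> C"
proof -
  have bound: "(\<Sum>\<sigma>\<in>F. m \<sigma> * (g \<sigma>)\<^sup>2) \<le> C" if F: "finite F" "F \<subseteq> X" for F
  proof (rule LIMSEQ_le[OF _ assms(5)])
    show "(\<lambda>n. \<Sum>\<sigma>\<in>F. m \<sigma> * (f n \<sigma>)\<^sup>2) \<longlonglongrightarrow> (\<Sum>\<sigma>\<in>F. m \<sigma> * (g \<sigma>)\<^sup>2)"
      using F assms(3) by (intro tendsto_intros) auto
    have "(\<Sum>\<sigma>\<in>F. m \<sigma> * (f n \<sigma>)\<^sup>2) \<le> nsq (f n)" for n
      unfolding nsq_def using F assms(1) m_nonneg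
      by (intro finite_sum_le_infsum) (auto simp: l2_iff)
    then show "\<exists>N. \<forall>n\<ge>N. (\<Sum>\<sigma>\<in>F. m \<sigma> * (f n \<sigma>)\<^sup>2) \<le> c n"
      using assms(4) order_trans by blast
  qed
  have "(\<lambda>\<sigma>. m \<sigma> * (g \<sigma>)\<^sup>2) summable_on X"
    using bound m_nonneg
    by (intro nonneg_bdd_above_summable_on) (auto intro!: bdd_aboveI2)
  then show ?thesis
    using assms(2) bound unfolding nsq_def l2_iff by (auto intro!: infsum_le_finite_sums)
qed

section \<open>Finitely supported cochains\<close>

text \<open>A finitely supported cochain is built from indicators one face at a time, by induction
  on a finite set containing the support. The factor \<open>1 *\<close> gives the sum the shape of
  the linear combinations in \<open>d_lin\<close>, \<open>bdry_lin\<close> and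
  \<open>l2_lin\<close>.\<close>

lemma fin_cochains_induct [consumes 1, case_names zero add]:
  assumes "\<phi> \<in> fin_cochains X"
    and zero: "P (\<lambda>\<sigma>. 0)"
    and add: "\<And>\<rho> c \<psi>. \<rho> \<in> X \<Longrightarrow> \<psi> \<in> fin_cochains X \<Longrightarrow> P \<psi> \<Longrightarrow>
      P (\<lambda>\<sigma>. 1 * \<psi> \<sigma> + c * indicator {\<rho>} \<sigma>)"
  shows "P \<phi>"
proof -
  have "P \<phi>" if "finite N" "N \<subseteq> X" "\<And>\<sigma>. \<sigma> \<notin> N \<Longrightarrow> \<phi> \<sigma> = 0" for N \<phi>
    using that
  proof (induction arbitrary: \<phi> rule: finite_induct)
    case empty
    then have "\<phi> = (\<lambda>\<sigma>. 0)" by auto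
    then show ?case using zero by simp
  next
    case (insert \<rho> N)
    let ?\<psi> = "\<phi>(\<rho> := 0)"
    have "{\<sigma>. ?\<psi> \<sigma> \<noteq> 0} \<subseteq> N" using insert.prems by auto
    then have "finite {\<sigma>. ?\<psi> \<sigma> \<noteq> 0}" using insert.hyps(1) by (rule finite_subset)
    moreover have "?\<psi> \<in> cochains X" using insert.prems by (auto simp: cochains_def)
    ultimately have fin: "?\<psi> \<in> fin_cochains X" by (simp add: fin_cochains_def)
    have P: "P ?\<psi>" using insert.prems by (intro insert.IH) auto
    have "P (\<lambda>\<sigma>. 1 * ?\<psi> \<sigma> + \<phi> \<rho> * indicator {\<rho>} \<sigma>)"
      by (rule add[OF _ fin P]) (use insert.prems in simp)
    moreover have "(\<lambda>\<sigma>. 1 * ?\<psi> \<sigma> + \<phi> \<rho> * indicator {\<rho>} \<sigma>) = \<phi>" by (auto simp: fun_eq_iff)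
    ultimately show ?case by simp
  qed
  note * = this
  show ?thesis
  proof (rule *)
    show "finite {\<sigma>. \<phi> \<sigma> \<noteq> 0}" "{\<sigma>. \<phi> \<sigma> \<noteq> 0} \<subseteq> X"
      using assms(1) by (auto simp: fin_cochains_def cochains_def)
  qed simp
qed

lemma indicator_fin: "\<rho> \<in> X \<Longrightarrow> indicator {\<rho>} \<in> fin_cochains X"
  by (auto simp: fin_cochains_def cochains_def indicator_def)

lemma fin_cochains_lin:
  assumes "\<phi> \<in> fin_cochains X" "\<psi> \<in> fin_cochains X"
  shows "(\<lambda>\<sigma>. a * \<phi> \<sigma> + b * \<psi> \<sigma>) \<in> fin_cochains X"
proof -
  have "{\<sigma>. a * \<phi> \<sigma> + b * \<psi> \<sigma> \<noteq> 0} \<subseteq> {\<sigma>. \<phi> \<sigma> \<noteq> 0} \<union> {\<sigma>. \<psi> \<sigma> \<noteq> 0}" by auto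
  moreover have "finite ({\<sigma>. \<phi> \<sigma> \<noteq> 0} \<union> {\<sigma>. \<psi> \<sigma> \<noteq> 0})"
    using assms by (simp add: fin_cochains_def)
  ultimately have "finite {\<sigma>. a * \<phi> \<sigma> + b * \<psi> \<sigma> \<noteq> 0}" by (rule finite_subset)
  then show ?thesis using assms by (simp add: fin_cochains_def cochains_lin)
qed

lemma fin_l2:
  assumes "\<phi> \<in> fin_cochains X"
  shows "\<phi> \<in> l2 X m"
proof -
  have "(\<lambda>\<sigma>. m \<sigma> * (\<phi> \<sigma>)\<^sup>2) summable_on {\<sigma>. \<phi> \<sigma> \<noteq> 0}"
    using assms by (auto simp: fin_cochains_def)
  also have "?this \<longleftrightarrow> (\<lambda>\<sigma>. m \<sigma> * (\<phi> \<sigma>)\<^sup>2) summable_on X"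
    using assms by (intro summable_on_cong_neutral) (auto simp: fin_cochains_def cochains_def)
  finally show ?thesis using assms by (simp add: l2_iff fin_cochains_def)
qed

lemma ip_indicator: "\<rho> \<in> X \<Longrightarrow> ip f (indicator {\<rho>}) = m \<rho> * f \<rho>"
  unfolding l2_inner_def
  by (subst infsum_cong_neutral[where T = "{\<rho>}" and g = "\<lambda>\<sigma>. m \<sigma> * f \<sigma>"]) auto


section \<open>Boundary and coboundary\<close>

lemma d_cochains: "\<omega> \<in> cochains X \<Longrightarrow> d \<omega> \<in> cochains X"
  using coboundary by (simp add: coboundary_map_def)

lemma d_lin:
  assumes "\<omega> \<in> cochains X" "\<eta> \<in> cochains X"
  shows "d (\<lambda>\<sigma>. a * \<omega> \<sigma> + b * \<eta> \<sigma>) = (\<lambda>\<sigma>. a * d \<omega> \<sigma> + b * d \<eta> \<sigma>)"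
  using coboundary assms by (simp add: coboundary_map_def)

lemma d_d: "\<omega> \<in> cochains X \<Longrightarrow> d (d \<omega>) = (\<lambda>\<sigma>. 0)"
  using coboundary by (simp add: coboundary_map_def)

lemma d_apply:
  assumes "\<omega> \<in> cochains X" "\<sigma> \<in> X"
  shows "d \<omega> \<sigma> = (\<Sum>\<tau> | \<tau> \<in> X \<and> \<tau> \<prec>\<^sub>1 \<sigma>. \<omega> \<tau> * theta d \<tau> \<sigma>)"
  using coboundary assms by (simp add: coboundary_map_def)

lemma theta_cases:
  assumes "\<tau> \<in> X" "\<sigma> \<in> X"
  shows "theta d \<tau> \<sigma> \<in> {-1, 0, 1}" "theta d \<tau> \<sigma> \<noteq> 0 \<longleftrightarrow> \<tau> \<prec>\<^sub>1 \<sigma>"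
  using coboundary assms by (simp_all add: coboundary_map_def)

lemma abs_theta: "\<tau> \<in> X \<Longrightarrow> \<sigma> \<in> cofaces X \<tau> \<Longrightarrow> \<bar>theta d \<tau> \<sigma>\<bar> = 1"
  using theta_cases[of \<tau> \<sigma>] by (auto simp: cofaces_def)

lemma theta_sq: "\<tau> \<in> X \<Longrightarrow> \<sigma> \<in> cofaces X \<tau> \<Longrightarrow> (theta d \<tau> \<sigma>)\<^sup>2 = 1"
  using abs_theta[of \<tau> \<sigma>] by (simp add: power2_eq_1_iff abs_eq_iff')

lemma indicator_cochains: "\<rho> \<in> X \<Longrightarrow> indicator {\<rho>} \<in> cochains X"
  by (auto simp: cochains_def indicator_def)

lemma facets_finite: "\<sigma> \<in> X \<Longrightarrow> finite {\<tau>. \<tau> \<in> X \<and> \<tau> \<prec>\<^sub>1 \<sigma>}"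
  by (rule finite_subset[of _ "Pow \<sigma>"]) (auto simp: covered_by_def face_finite)

text \<open>The formula of \<open>boundary_op\<close> as a total function, without the restriction
  of the domain. It stands for the boundary operator only on \<open>cochains1 X m\<close>; a
  divergent series would silently count as 0.\<close>

definition bdry :: "'v cochain \<Rightarrow> 'v cochain" where
  "bdry \<omega> = (\<lambda>\<rho>. if \<rho> \<in> X
     then 1 / m \<rho> * (\<Sum>\<^sub>\<infinity>\<tau>\<in>cofaces X \<rho>. m \<tau> * \<omega> \<tau> * theta d \<rho> \<tau>) else 0)"

lemma bdry_cochains: "bdry \<omega> \<in> cochains X"
  by (simp add: bdry_def cochains_def)

lemma cofaces_subset: "cofaces X \<tau> \<subseteq> X"
  by (auto simp: cofaces_def)

lemma cochains1_summable:
  assumes "\<omega> \<in> cochains1 X m" "\<rho> \<in> X"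
  shows "(\<lambda>\<tau>. m \<tau> * \<omega> \<tau> * theta d \<rho> \<tau>) summable_on cofaces X \<rho>"
proof (rule summable_on_real_comparison)
  show "(\<lambda>\<sigma>. m \<sigma> * \<bar>\<omega> \<sigma>\<bar>) summable_on cofaces X \<rho>"
    using assms by (simp add: cochains1_def)
  fix \<tau> assume "\<tau> \<in> cofaces X \<rho>"
  then have "\<tau> \<in> X" using cofaces_subset by auto
  then show "\<bar>m \<tau> * \<omega> \<tau> * theta d \<rho> \<tau>\<bar> \<le> m \<tau> * \<bar>\<omega> \<tau>\<bar>"
    using m_nonneg abs_theta[OF assms(2) \<open>\<tau> \<in> cofaces X \<rho>\<close>] by (simp add: abs_mult)
qed

lemma cochains1_lin:
  assumes "\<omega> \<in> cochains1 X m" "\<eta> \<in> cochains1 X m"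
  shows "(\<lambda>\<sigma>. a * \<omega> \<sigma> + b * \<eta> \<sigma>) \<in> cochains1 X m"
proof -
  have "(\<lambda>\<sigma>. m \<sigma> * \<bar>a * \<omega> \<sigma> + b * \<eta> \<sigma>\<bar>) summable_on cofaces X \<tau>" if "\<tau> \<in> X" for \<tau>
  proof (rule summable_on_real_comparison)
    show "(\<lambda>\<sigma>. \<bar>a\<bar> * (m \<sigma> * \<bar>\<omega> \<sigma>\<bar>) + \<bar>b\<bar> * (m \<sigma> * \<bar>\<eta> \<sigma>\<bar>)) summable_on cofaces X \<tau>"
      using assms that by (intro summable_on_add summable_on_cmult_right) (auto simp: cochains1_def)
    fix \<sigma> assume "\<sigma> \<in> cofaces X \<tau>"
    then have m: "0 \<le> m \<sigma>" using cofaces_subset m_nonneg by auto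
    have "m \<sigma> * \<bar>a * \<omega> \<sigma> + b * \<eta> \<sigma>\<bar> \<le> m \<sigma> * (\<bar>a\<bar> * \<bar>\<omega> \<sigma>\<bar> + \<bar>b\<bar> * \<bar>\<eta> \<sigma>\<bar>)"
      using m by (intro mult_left_mono) (auto simp: abs_mult[symmetric] abs_triangle_ineq)
    then show "\<bar>m \<sigma> * \<bar>a * \<omega> \<sigma> + b * \<eta> \<sigma>\<bar>\<bar> \<le> \<bar>a\<bar> * (m \<sigma> * \<bar>\<omega> \<sigma>\<bar>) + \<bar>b\<bar> * (m \<sigma> * \<bar>\<eta> \<sigma>\<bar>)"
      using m by (simp add: abs_mult algebra_simps)
  qed
  then show ?thesis using assms by (auto simp: cochains1_def cochains_lin)
qed

lemma bdry_lin:
  assumes "\<omega> \<in> cochains1 X m" "\<eta> \<in> cochains1 X m"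
  shows "bdry (\<lambda>\<sigma>. a * \<omega> \<sigma> + b * \<eta> \<sigma>) = (\<lambda>\<sigma>. a * bdry \<omega> \<sigma> + b * bdry \<eta> \<sigma>)"
proof
  fix \<rho>
  show "bdry (\<lambda>\<sigma>. a * \<omega> \<sigma> + b * \<eta> \<sigma>) \<rho> = a * bdry \<omega> \<rho> + b * bdry \<eta> \<rho>"
  proof (cases "\<rho> \<in> X")
    case True
    have "(\<Sum>\<^sub>\<infinity>\<tau>\<in>cofaces X \<rho>. m \<tau> * (a * \<omega> \<tau> + b * \<eta> \<tau>) * theta d \<rho> \<tau>)
        = (\<Sum>\<^sub>\<infinity>\<tau>\<in>cofaces X \<rho>. a * (m \<tau> * \<omega> \<tau> * theta d \<rho> \<tau>) + b * (m \<tau> * \<eta> \<tau> * theta d \<rho> \<tau>))"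
      by (simp add: algebra_simps)
    also have "\<dots> = (\<Sum>\<^sub>\<infinity>\<tau>\<in>cofaces X \<rho>. a * (m \<tau> * \<omega> \<tau> * theta d \<rho> \<tau>))
        + (\<Sum>\<^sub>\<infinity>\<tau>\<in>cofaces X \<rho>. b * (m \<tau> * \<eta> \<tau> * theta d \<rho> \<tau>))"
      using assms True by (intro infsum_add summable_on_cmult_right cochains1_summable)
    finally show ?thesis using True by (simp add: bdry_def infsum_cmult_right' algebra_simps add_divide_distrib)
  qed (simp add: bdry_def)
qed

text \<open>Since \<open>|x| <= 1 + x^2\<close>, the series is dominated by the mass of the cofaces,
  finite by local summability, plus part of the squared norm.\<close>

lemma l2_cochains1:
  assumes "\<omega> \<in> l2 X m"
  shows "\<omega> \<in> cochains1 X m"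
proof -
  have "(\<lambda>\<sigma>. m \<sigma> * \<bar>\<omega> \<sigma>\<bar>) summable_on cofaces X \<tau>" if "\<tau> \<in> X" for \<tau>
  proof (rule summable_on_real_comparison)
    show "(\<lambda>\<sigma>. m \<sigma> + m \<sigma> * (\<omega> \<sigma>)\<^sup>2) summable_on cofaces X \<tau>"
      using assms that loc_summable cofaces_subset
      by (intro summable_on_add) (auto simp: l2_iff locally_summable_def intro: summable_on_subset_banach)
    fix \<sigma> assume "\<sigma> \<in> cofaces X \<tau>"
    then have m: "0 \<le> m \<sigma>" using cofaces_subset m_nonneg by auto
    have "\<bar>\<omega> \<sigma>\<bar> \<le> 1 + (\<omega> \<sigma>)\<^sup>2"
      using sum_squares_bound[of "\<bar>\<omega> \<sigma>\<bar>" 1] by simp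
    then have "m \<sigma> * \<bar>\<omega> \<sigma>\<bar> \<le> m \<sigma> * (1 + (\<omega> \<sigma>)\<^sup>2)" using m by (intro mult_left_mono)
    then show "\<bar>m \<sigma> * \<bar>\<omega> \<sigma>\<bar>\<bar> \<le> m \<sigma> + m \<sigma> * (\<omega> \<sigma>)\<^sup>2"
      using m by (simp add: abs_mult algebra_simps)
  qed
  then show ?thesis using assms by (auto simp: cochains1_def l2_iff)
qed

lemma cochains1_cochains: "\<omega> \<in> cochains1 X m \<Longrightarrow> \<omega> \<in> cochains X"
  by (simp add: cochains1_def)

lemma l2_cochains: "\<omega> \<in> l2 X m \<Longrightarrow> \<omega> \<in> cochains X"
  by (simp add: l2_iff)

section \<open>Adjointness of coboundary and boundary, tested on indicators\<close>

lemma d_indicator: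
  assumes "\<rho> \<in> X"
  shows "d (indicator {\<rho>}) \<sigma> = (if \<sigma> \<in> cofaces X \<rho> then theta d \<rho> \<sigma> else 0)"
proof (cases "\<sigma> \<in> X")
  case True
  then show ?thesis using theta_cases(2)[OF assms True] by (auto simp: theta_def cofaces_def)
next
  case False
  then show ?thesis
    using d_cochains[OF indicator_cochains[OF assms]] by (auto simp: cochains_def cofaces_def)
qed

text \<open>As the signs square to 1, the squared norm is the total mass of the cofaces of
  \<open>\<rho>\<close>, which local summability makes finite.\<close>

lemma d_indicator_l2:
  assumes "\<rho> \<in> X"
  shows "d (indicator {\<rho>}) \<in> l2 X m"
proof -
  have "m summable_on cofaces X \<rho>"
    using loc_summable assms by (simp add: locally_summable_def)
  also have "?this \<longleftrightarrow> (\<lambda>\<sigma>. m \<sigma> * (d (indicator {\<rho>}) \<sigma>)\<^sup>2) summable_on X"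
    by (rule summable_on_cong_neutral)
       (use assms cofaces_subset in \<open>auto simp: d_indicator theta_sq\<close>)
  finally show ?thesis using assms by (simp add: l2_iff d_cochains indicator_cochains)
qed

text \<open>Both sides come from the same \<open>infsum\<close> over the cofaces of
  \<open>\<rho>\<close>. This remains true when the series diverges and takes the value 0, so
  \<open>f\<close> is arbitrary.\<close>

lemma ip_d_indicator:
  assumes "\<rho> \<in> X"
  shows "ip f (d (indicator {\<rho>})) = m \<rho> * bdry f \<rho>"
proof -
  have "ip f (d (indicator {\<rho>})) = (\<Sum>\<^sub>\<infinity>\<tau>\<in>cofaces X \<rho>. m \<tau> * f \<tau> * theta d \<rho> \<tau>)"
    unfolding l2_inner_def
    by (rule infsum_cong_neutral) (use assms cofaces_subset in \<open>auto simp: d_indicator\<close>)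
  then show ?thesis using m_pos[OF assms] assms by (simp add: bdry_def)
qed

text \<open>Among the cofaces of \<open>\<tau>\<close> only \<open>\<rho>\<close> itself can
  contribute to the defining sum.\<close>

lemma bdry_indicator:
  assumes "\<rho> \<in> X"
  shows "bdry (indicator {\<rho>}) \<tau>
    = (if \<tau> \<in> X \<and> \<tau> \<prec>\<^sub>1 \<rho> then m \<rho> / m \<tau> * theta d \<tau> \<rho> else 0)"
proof (cases "\<tau> \<in> X")
  case True
  have "(\<Sum>\<^sub>\<infinity>\<sigma>\<in>cofaces X \<tau>. m \<sigma> * indicator {\<rho>} \<sigma> * theta d \<tau> \<sigma>)
      = (\<Sum>\<^sub>\<infinity>\<sigma>\<in>(if \<tau> \<prec>\<^sub>1 \<rho> then {\<rho>} else {}). m \<rho> * theta d \<tau> \<rho>)"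
    by (rule infsum_cong_neutral)
       (use assms in \<open>auto simp: cofaces_def indicator_def split: if_splits\<close>)
  then show ?thesis using True by (simp add: bdry_def)
qed (simp add: bdry_def)

lemma bdry_indicator_fin:
  assumes "\<rho> \<in> X"
  shows "bdry (indicator {\<rho>}) \<in> fin_cochains X"
proof -
  have "{\<tau>. bdry (indicator {\<rho>}) \<tau> \<noteq> 0} \<subseteq> {\<tau>. \<tau> \<in> X \<and> \<tau> \<prec>\<^sub>1 \<rho>}"
    using assms by (auto simp: bdry_indicator split: if_splits)
  then have "finite {\<tau>. bdry (indicator {\<rho>}) \<tau> \<noteq> 0}"
    using facets_finite[OF assms] by (rule finite_subset)
  then show ?thesis by (simp add: fin_cochains_def bdry_cochains)
qed

text \<open>The mass of \<open>\<tau>\<close> cancels against the factor \<open>1 / m \<tau>\<close>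
  of the boundary, leaving the formula for \<open>d f \<rho>\<close>. The sum runs over the finitely
  many facets of \<open>\<rho>\<close>, so \<open>f\<close> may be any cochain.\<close>

lemma ip_bdry_indicator:
  assumes "\<rho> \<in> X" "f \<in> cochains X"
  shows "ip f (bdry (indicator {\<rho>})) = m \<rho> * d f \<rho>"
proof -
  have "ip f (bdry (indicator {\<rho>}))
      = (\<Sum>\<^sub>\<infinity>\<tau>\<in>{\<tau>. \<tau> \<in> X \<and> \<tau> \<prec>\<^sub>1 \<rho>}. m \<rho> * (f \<tau> * theta d \<tau> \<rho>))"
    unfolding l2_inner_def
  proof (rule infsum_cong_neutral)
    fix \<tau> assume "\<tau> \<in> X \<inter> {\<tau>. \<tau> \<in> X \<and> \<tau> \<prec>\<^sub>1 \<rho>}"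
    then show "m \<tau> * f \<tau> * bdry (indicator {\<rho>}) \<tau> = m \<rho> * (f \<tau> * theta d \<tau> \<rho>)"
      using m_pos[of \<tau>] assms by (simp add: bdry_indicator)
  qed (use assms in \<open>auto simp: bdry_indicator\<close>)
  also have "\<dots> = m \<rho> * d f \<rho>"
    using facets_finite[OF assms(1)] assms by (simp add: d_apply sum_distrib_left)
  finally show ?thesis .
qed

lemma d_zero: "d (\<lambda>\<sigma>. 0) = (\<lambda>\<sigma>. 0)"
  using d_lin[of "\<lambda>\<sigma>. 0" "\<lambda>\<sigma>. 0" 0 0] by (simp add: cochains_def)

lemma bdry_zero: "bdry (\<lambda>\<sigma>. 0) = (\<lambda>\<sigma>. 0)"
  by (auto simp: bdry_def)

lemma fin_d_l2: "\<phi> \<in> fin_cochains X \<Longrightarrow> d \<phi> \<in> l2 X m"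
proof (induction rule: fin_cochains_induct)
  case zero
  then show ?case by (simp add: d_zero l2_zero)
next
  case (add \<rho> c \<psi>)
  have "d (\<lambda>\<sigma>. 1 * \<psi> \<sigma> + c * indicator {\<rho>} \<sigma>)
      = (\<lambda>\<sigma>. 1 * d \<psi> \<sigma> + c * d (indicator {\<rho>}) \<sigma>)"
    using add by (intro d_lin l2_cochains fin_l2 indicator_fin)
  also have "\<dots> \<in> l2 X m" using add by (intro l2_lin d_indicator_l2)
  finally show ?case .
qed

lemma fin_bdry_l2: "\<phi> \<in> fin_cochains X \<Longrightarrow> bdry \<phi> \<in> l2 X m"
proof (induction rule: fin_cochains_induct)
  case zero
  then show ?case by (simp add: bdry_zero l2_zero)
next
  case (add \<rho> c \<psi>)
  have "bdry (\<lambda>\<sigma>. 1 * \<psi> \<sigma> + c * indicator {\<rho>} \<sigma>)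
      = (\<lambda>\<sigma>. 1 * bdry \<psi> \<sigma> + c * bdry (indicator {\<rho>}) \<sigma>)"
    using add by (intro bdry_lin l2_cochains1 fin_l2 indicator_fin)
  also have "\<dots> \<in> l2 X m" using add by (intro l2_lin fin_l2[OF bdry_indicator_fin])
  finally show ?case .
qed

text \<open>Against the boundary of an indicator the pairing is
  \<open>m \<rho> * d f \<rho> = 0\<close>; linearity extends this to finite support.\<close>

lemma ip_bdry_fin:
  assumes "\<phi> \<in> fin_cochains X" "f \<in> l2 X m" "d f = (\<lambda>\<sigma>. 0)"
  shows "ip f (bdry \<phi>) = 0"
  using assms(1)
proof (induction rule: fin_cochains_induct)
  case zero
  then show ?case by (simp add: bdry_zero l2_inner_def)
next
  case (add \<rho> c \<psi>)
  have "bdry (\<lambda>\<sigma>. 1 * \<psi> \<sigma> + c * indicator {\<rho>} \<sigma>)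
      = (\<lambda>\<sigma>. 1 * bdry \<psi> \<sigma> + c * bdry (indicator {\<rho>}) \<sigma>)"
    using add.hyps by (intro bdry_lin l2_cochains1 fin_l2 indicator_fin)
  moreover have "ip f (\<lambda>\<sigma>. 1 * bdry \<psi> \<sigma> + c * bdry (indicator {\<rho>}) \<sigma>)
      = 1 * ip f (bdry \<psi>) + c * ip f (bdry (indicator {\<rho>}))"
    using add.hyps assms(2) by (intro ip_lin_right fin_bdry_l2 indicator_fin)
  moreover have "ip f (bdry (indicator {\<rho>})) = 0"
    using add.hyps assms by (simp add: ip_bdry_indicator l2_cochains)
  ultimately show ?case using add.IH by simp
qed

text \<open>Take \<open>f = d \<psi>\<close> above, which is closed because the coboundary squares
  to zero. This orthogonality later gives Pythagoras for the sum of the two operators.\<close>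

lemma ip_d_bdry_fin:
  assumes "\<phi> \<in> fin_cochains X" "\<psi> \<in> fin_cochains X"
  shows "ip (d \<psi>) (bdry \<phi>) = 0"
  using assms by (intro ip_bdry_fin fin_d_l2) (auto simp: d_d l2_cochains fin_l2)


section \<open>Operators associated with forms\<close>

text \<open>Collects what the three first-order operators share, so that forms and associated
  operators are treated once for all three.\<close>

definition lin_map :: "'v cochain set \<Rightarrow> ('v cochain \<Rightarrow> 'v cochain) \<Rightarrow> bool" where
  "lin_map D a \<longleftrightarrow> D \<subseteq> cochains X \<and> (\<forall>\<omega>\<in>D. a \<omega> \<in> cochains X) \<and>
     (\<forall>\<omega>\<in>D. \<forall>\<eta>\<in>D. \<forall>s t. (\<lambda>\<sigma>. s * \<omega> \<sigma> + t * \<eta> \<sigma>) \<in> D \<and>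
        a (\<lambda>\<sigma>. s * \<omega> \<sigma> + t * \<eta> \<sigma>) = (\<lambda>\<sigma>. s * a \<omega> \<sigma> + t * a \<eta> \<sigma>))"

definition op_on :: "'v cochain set \<Rightarrow> ('v cochain \<Rightarrow> 'v cochain) \<Rightarrow> ('v cochain \<rightharpoonup> 'v cochain)" where
  "op_on D a = (\<lambda>\<omega>. Some (a \<omega>)) |` D"

lemma lin_mapD:
  assumes "lin_map D a" "\<omega> \<in> D" "\<eta> \<in> D"
  shows "(\<lambda>\<sigma>. s * \<omega> \<sigma> + t * \<eta> \<sigma>) \<in> D"
    and "a (\<lambda>\<sigma>. s * \<omega> \<sigma> + t * \<eta> \<sigma>) = (\<lambda>\<sigma>. s * a \<omega> \<sigma> + t * a \<eta> \<sigma>)"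
  using assms unfolding lin_map_def by blast+

lemma form_N_op:
  assumes "lin_map D a"
  shows "form_N X m (op_on D a) \<omega> =
    (if \<omega> \<in> D \<and> a \<omega> \<in> l2 X m \<and> \<omega> \<in> l2 X m then Some (nsq (a \<omega>)) else None)"
proof -
  have "\<omega> \<in> finite_domain (ext_form X m (op_on D a)) \<longleftrightarrow> \<omega> \<in> D \<and> a \<omega> \<in> l2 X m"
    using assms
    by (auto simp: finite_domain_def ext_form_def op_on_def restrict_map_def l2_def lin_map_def
        split: if_splits)
  then show ?thesis
    by (auto simp: form_N_def restrict_map_def ext_form_def op_on_def sqnorm_l2)
qed

text \<open>The constant sequence \<open>\<phi>\<close> is an approximation whose error is the zero
  cochain.\<close>

lemma fin_dom_form_D:
  assumes "lin_map D a" "\<phi> \<in> fin_cochains X" "\<phi> \<in> D" "a \<phi> \<in> l2 X m"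
  shows "\<phi> \<in> dom (form_D X m (op_on D a))"
proof -
  have 0: "(\<lambda>\<sigma>. 0) \<in> D" "a (\<lambda>\<sigma>. 0) = (\<lambda>\<sigma>. 0)"
    using lin_mapD[OF assms(1,3,3), of 0 0] by simp_all
  have nz: "nsq (\<lambda>\<sigma>. 0) = 0" by (simp add: nsq_def)
  have "form_norm X m (form_N X m (op_on D a)) (\<lambda>\<sigma>. 0) = 0"
    using assms(1) by (simp add: form_norm_def form_N_op 0 l2_zero sqnorm_l2 nz)
  then have "\<exists>f. (\<forall>n::nat. f n \<in> fin_cochains X) \<and>
      (\<lambda>n. form_norm X m (form_N X m (op_on D a)) (\<lambda>\<sigma>. f n \<sigma> - \<phi> \<sigma>)) \<longlonglongrightarrow> 0"
    using assms(2) by (intro exI[of _ "\<lambda>_. \<phi>"]) simp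
  moreover have "\<phi> \<in> dom (form_N X m (op_on D a))"
    using assms by (simp add: form_N_op dom_def fin_l2)
  ultimately show ?thesis by (simp add: form_D_def)
qed

lemma polar_eq_ip:
  assumes "lin_map D a" "positive_form X m q" "q \<subseteq>\<^sub>m form_N X m (op_on D a)"
    and "\<omega> \<in> dom q" "\<psi> \<in> dom q"
  shows "polar q \<omega> \<psi> = ip (a \<omega>) (a \<psi>)"
proof -
  have q: "\<xi> \<in> D \<and> a \<xi> \<in> l2 X m \<and> the (q \<xi>) = nsq (a \<xi>)" if "\<xi> \<in> dom q" for \<xi>
  proof -
    have "q \<xi> = form_N X m (op_on D a) \<xi>" using assms(3) that by (auto simp: map_le_def)
    then show ?thesis using that form_N_op[OF assms(1), of \<xi>] by (auto split: if_splits)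
  qed
  have "(\<lambda>\<sigma>. s * \<omega> \<sigma> + t * \<psi> \<sigma>) \<in> dom q" for s t
    using assms(2,4,5) unfolding positive_form_def by blast
  from q[OF this] have "the (q (\<lambda>\<sigma>. s * \<omega> \<sigma> + t * \<psi> \<sigma>))
      = s\<^sup>2 * nsq (a \<omega>) + 2 * s * t * ip (a \<omega>) (a \<psi>) + t\<^sup>2 * nsq (a \<psi>)" for s t
    using q[OF assms(4)] q[OF assms(5)] lin_mapD(2)[OF assms(1), of \<omega> \<psi> s t]
    by (simp add: nsq_lin)
  \<comment> \<open>The two choices are the arguments of the two terms in \<open>polar\<close>. The
    squared norms cancel and four times the inner product remains.\<close>
  from this[of 1 1] this[of 1 "-1"] show ?thesis by (simp add: polar_def)
qed

lemma cochains_eqI: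
  assumes "f \<in> cochains X" "g \<in> cochains X" "\<And>\<rho>. \<rho> \<in> X \<Longrightarrow> m \<rho> * f \<rho> = m \<rho> * g \<rho>"
  shows "f = g"
proof
  fix \<rho> show "f \<rho> = g \<rho>"
    using assms(1,2) assms(3)[of \<rho>] m_pos[of \<rho>] by (cases "\<rho> \<in> X") (auto simp: cochains_def)
qed

text \<open>Indicators lie in the domain of \<open>q\<close> and pick out single values, so testing
  a representing \<open>\<eta>\<close> against them forces \<open>\<eta> = b\<close>. This also
  gives the uniqueness that \<open>THE\<close> needs. That \<open>b\<close> lies in l2 is a
  consequence and is not checked beforehand.\<close>

lemma form_operator_apply:
  assumes "lin_map D a" and fin: "\<And>\<phi>. \<phi> \<in> fin_cochains X \<Longrightarrow> \<phi> \<in> D \<and> a \<phi> \<in> l2 X m"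
    and q: "positive_form X m q" "form_D X m (op_on D a) \<subseteq>\<^sub>m q" "q \<subseteq>\<^sub>m form_N X m (op_on D a)"
    and \<omega>: "\<omega> \<in> dom (form_operator X m q)"
    and b: "b \<in> cochains X" "\<And>\<rho>. \<rho> \<in> X \<Longrightarrow> ip (a \<omega>) (a (indicator {\<rho>})) = m \<rho> * b \<rho>"
  shows "form_operator X m q \<omega> = Some b"
proof -
  from \<omega> have dom: "\<omega> \<in> dom q" and ex: "\<exists>\<eta>. represents X m q \<omega> \<eta>"
    by (auto simp: form_operator_def restrict_map_def split: if_splits)
  have eq: "\<eta> = b" if \<eta>: "represents X m q \<omega> \<eta>" for \<eta>
  proof (rule cochains_eqI)
    show "\<eta> \<in> cochains X" using \<eta> by (simp add: represents_def l2_cochains)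
    fix \<rho> assume \<rho>: "\<rho> \<in> X"
    then have "indicator {\<rho>} \<in> dom (form_D X m (op_on D a))"
      using fin by (intro fin_dom_form_D assms(1)) (auto simp: indicator_fin)
    then have ind: "indicator {\<rho>} \<in> dom q" using q(2) map_le_implies_dom_le by blast
    have "m \<rho> * \<eta> \<rho> = ip \<eta> (indicator {\<rho>})" using \<rho> by (simp add: ip_indicator)
    also have "\<dots> = polar q \<omega> (indicator {\<rho>})"
      using \<eta> ind by (simp add: represents_def)
    also have "\<dots> = ip (a \<omega>) (a (indicator {\<rho>}))"
      by (rule polar_eq_ip[OF assms(1) q(1,3) dom ind])
    finally show "m \<rho> * \<eta> \<rho> = m \<rho> * b \<rho>" using b(2)[OF \<rho>] by simp
  qed (rule b(1))
  then have "(THE \<eta>. represents X m q \<omega> \<eta>) = b" using ex by (metis the_equality)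
  then show ?thesis using dom ex by (simp add: form_operator_def)
qed

lemma form_operator_dom:
  assumes "lin_map D a" "q \<subseteq>\<^sub>m form_N X m (op_on D a)" "\<omega> \<in> dom (form_operator X m q)"
  shows "\<omega> \<in> D" "a \<omega> \<in> l2 X m" "\<omega> \<in> l2 X m"
proof -
  have "\<omega> \<in> dom q"
    using assms(3) by (auto simp: form_operator_def restrict_map_def split: if_splits)
  then have "\<omega> \<in> dom (form_N X m (op_on D a))" using assms(2) map_le_implies_dom_le by blast
  then show "\<omega> \<in> D" "a \<omega> \<in> l2 X m" "\<omega> \<in> l2 X m"
    by (auto simp: dom_def form_N_op[OF assms(1)] split: if_splits)
qed

section \<open>The three Laplacians as compositions of first-order operators\<close>

lemma coboundary_op_eq: "coboundary_op X d = op_on (cochains X) d"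
  by (simp add: coboundary_op_def op_on_def)

lemma boundary_op_eq: "boundary_op X m d = op_on (cochains1 X m) bdry"
  by (simp add: boundary_op_def op_on_def bdry_def)

text \<open>The Hodge-Dirac operator, whose square is the Hodge Laplacian.\<close>

definition dirac :: "'v cochain \<Rightarrow> 'v cochain" where
  "dirac \<omega> = (\<lambda>\<sigma>. d \<omega> \<sigma> + bdry \<omega> \<sigma>)"

lemma dirac_op_eq: "coboundary_op X d \<oplus>\<^sub>m boundary_op X m d = op_on (cochains1 X m) dirac"
proof
  fix \<omega> show "(coboundary_op X d \<oplus>\<^sub>m boundary_op X m d) \<omega> = op_on (cochains1 X m) dirac \<omega>"
    using cochains1_cochains[of \<omega>]
    by (auto simp: op_plus_def coboundary_op_eq boundary_op_eq op_on_def dirac_def restrict_map_def dom_def)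
qed

lemma lin_map_d: "lin_map (cochains X) d"
  by (auto simp: lin_map_def d_cochains d_lin cochains_lin)

lemma lin_map_bdry: "lin_map (cochains1 X m) bdry"
  by (auto simp: lin_map_def bdry_cochains bdry_lin cochains1_lin cochains1_cochains)

lemma lin_map_dirac: "lin_map (cochains1 X m) dirac"
  unfolding lin_map_def
proof (intro conjI ballI allI)
  show "cochains1 X m \<subseteq> cochains X" by (auto simp: cochains1_cochains)
  fix \<omega> assume \<omega>: "\<omega> \<in> cochains1 X m"
  show "dirac \<omega> \<in> cochains X"
    using cochains_lin[of "d \<omega>" "bdry \<omega>" 1 1] d_cochains[OF cochains1_cochains[OF \<omega>]]
    by (simp add: dirac_def bdry_cochains)
  fix \<eta> s t assume \<eta>: "\<eta> \<in> cochains1 X m"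
  show "(\<lambda>\<sigma>. s * \<omega> \<sigma> + t * \<eta> \<sigma>) \<in> cochains1 X m" using \<omega> \<eta> by (rule cochains1_lin)
  show "dirac (\<lambda>\<sigma>. s * \<omega> \<sigma> + t * \<eta> \<sigma>) = (\<lambda>\<sigma>. s * dirac \<omega> \<sigma> + t * dirac \<eta> \<sigma>)"
    unfolding dirac_def d_lin[OF \<omega>[THEN cochains1_cochains] \<eta>[THEN cochains1_cochains]]
      bdry_lin[OF \<omega> \<eta>]
    by (simp add: algebra_simps)
qed

lemma fin_dirac_l2: "\<phi> \<in> fin_cochains X \<Longrightarrow> dirac \<phi> \<in> l2 X m"
  using l2_lin[of "d \<phi>" "bdry \<phi>" 1 1] by (simp add: dirac_def fin_d_l2 fin_bdry_l2)

text \<open>Adjointness is applied to \<open>f = d \<omega>\<close>. That \<open>d \<omega>\<close>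
  lies in l2 is recorded because it places \<open>d \<omega>\<close> in the domain of the
  boundary.\<close>

lemma upper_laplacian:
  assumes "laplacian X m (coboundary_op X d) L" "\<omega> \<in> dom L"
  shows "L \<omega> = Some (bdry (d \<omega>))" "\<omega> \<in> cochains X" "d \<omega> \<in> l2 X m"
proof -
  obtain q where q: "closed_form X m q" "form_D X m (op_on (cochains X) d) \<subseteq>\<^sub>m q"
    "q \<subseteq>\<^sub>m form_N X m (op_on (cochains X) d)" "L = form_operator X m q"
    using assms(1) by (auto simp: laplacian_def coboundary_op_eq)
  have \<omega>: "\<omega> \<in> dom (form_operator X m q)" using assms(2) q(4) by simp
  show "\<omega> \<in> cochains X" "d \<omega> \<in> l2 X m"
    using form_operator_dom[OF lin_map_d q(3) \<omega>] by auto
  show "L \<omega> = Some (bdry (d \<omega>))"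
    unfolding q(4)
    by (rule form_operator_apply[OF lin_map_d _ _ q(2,3) \<omega>])
       (use q(1) in \<open>auto simp: closed_form_def fin_d_l2 bdry_cochains ip_d_indicator
          l2_cochains fin_l2\<close>)
qed

lemma lower_laplacian:
  assumes "laplacian X m (boundary_op X m d) L" "\<omega> \<in> dom L"
  shows "L \<omega> = Some (d (bdry \<omega>))" "\<omega> \<in> cochains1 X m"
proof -
  obtain q where q: "closed_form X m q" "form_D X m (op_on (cochains1 X m) bdry) \<subseteq>\<^sub>m q"
    "q \<subseteq>\<^sub>m form_N X m (op_on (cochains1 X m) bdry)" "L = form_operator X m q"
    using assms(1) by (auto simp: laplacian_def boundary_op_eq)
  have \<omega>: "\<omega> \<in> dom (form_operator X m q)" using assms(2) q(4) by simp
  show "\<omega> \<in> cochains1 X m"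
    using form_operator_dom[OF lin_map_bdry q(3) \<omega>] by auto
  show "L \<omega> = Some (d (bdry \<omega>))"
    unfolding q(4)
    by (rule form_operator_apply[OF lin_map_bdry _ _ q(2,3) \<omega>])
       (use q(1) in \<open>auto simp: closed_form_def fin_bdry_l2 bdry_cochains ip_bdry_indicator
          d_cochains l2_cochains1 fin_l2\<close>)
qed

lemma hodge_laplacian:
  assumes "laplacian X m (coboundary_op X d \<oplus>\<^sub>m boundary_op X m d) L" "\<omega> \<in> dom L"
  shows "L \<omega> = Some (dirac (dirac \<omega>))" "\<omega> \<in> cochains1 X m" "dirac \<omega> \<in> l2 X m" "\<omega> \<in> l2 X m"
proof -
  obtain q where q: "closed_form X m q" "form_D X m (op_on (cochains1 X m) dirac) \<subseteq>\<^sub>m q"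
    "q \<subseteq>\<^sub>m form_N X m (op_on (cochains1 X m) dirac)" "L = form_operator X m q"
    using assms(1) by (auto simp: laplacian_def dirac_op_eq)
  have \<omega>: "\<omega> \<in> dom (form_operator X m q)" using assms(2) q(4) by simp
  show dom: "\<omega> \<in> cochains1 X m" "dirac \<omega> \<in> l2 X m" "\<omega> \<in> l2 X m"
    using form_operator_dom[OF lin_map_dirac q(3) \<omega>] by auto
  show "L \<omega> = Some (dirac (dirac \<omega>))"
    unfolding q(4)
  proof (rule form_operator_apply[OF lin_map_dirac _ _ q(2,3) \<omega>])
    show "dirac (dirac \<omega>) \<in> cochains X"
      using lin_map_dirac l2_cochains1[OF dom(2)] unfolding lin_map_def by blast
    fix \<rho> assume \<rho>: "\<rho> \<in> X"
    \<comment> \<open>The two halves of \<open>dirac (indicator {\<rho>})\<close> lie in l2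
      separately, so each can be moved across by its own adjointness relation.\<close>
    have "ip (dirac \<omega>) (\<lambda>\<sigma>. 1 * d (indicator {\<rho>}) \<sigma> + 1 * bdry (indicator {\<rho>}) \<sigma>)
        = 1 * ip (dirac \<omega>) (d (indicator {\<rho>})) + 1 * ip (dirac \<omega>) (bdry (indicator {\<rho>}))"
      using \<rho> dom by (intro ip_lin_right d_indicator_l2 fin_l2[OF bdry_indicator_fin])
    then show "ip (dirac \<omega>) (dirac (indicator {\<rho>})) = m \<rho> * dirac (dirac \<omega>) \<rho>"
      using \<rho> l2_cochains[OF dom(2)]
      unfolding dirac_def[of "indicator {\<rho>}"] dirac_def[of "dirac \<omega>"]
      by (simp add: ip_d_indicator ip_bdry_indicator algebra_simps)
  qed (use q(1) in \<open>auto simp: closed_form_def fin_dirac_l2 l2_cochains1 fin_l2\<close>)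
qed

lemma dirac_dirac:
  assumes "\<omega> \<in> cochains1 X m" "bdry (dirac \<omega>) = bdry (d \<omega>)"
  shows "dirac (dirac \<omega>) = (\<lambda>\<sigma>. bdry (d \<omega>) \<sigma> + d (bdry \<omega>) \<sigma>)"
proof -
  have "d (\<lambda>\<sigma>. 1 * d \<omega> \<sigma> + 1 * bdry \<omega> \<sigma>) = (\<lambda>\<sigma>. 1 * d (d \<omega>) \<sigma> + 1 * d (bdry \<omega>) \<sigma>)"
    using assms(1) by (intro d_lin d_cochains bdry_cochains cochains1_cochains)
  then have "d (dirac \<omega>) = d (bdry \<omega>)"
    using d_d[OF cochains1_cochains[OF assms(1)]] by (simp add: dirac_def)
  then show ?thesis
    unfolding dirac_def[of "dirac \<omega>"] assms(2) by (simp add: add.commute)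
qed


section \<open>Splitting the Hodge Laplacian\<close>

lemma nsq_minus: "nsq (\<lambda>\<sigma>. f \<sigma> - g \<sigma>) = nsq (\<lambda>\<sigma>. g \<sigma> - f \<sigma>)"
  by (simp add: nsq_def power2_commute)

lemma dirac_diff:
  assumes "\<omega> \<in> cochains1 X m" "\<eta> \<in> cochains1 X m"
  shows "dirac (\<lambda>\<sigma>. \<omega> \<sigma> - \<eta> \<sigma>) = (\<lambda>\<sigma>. dirac \<omega> \<sigma> - dirac \<eta> \<sigma>)"
  using lin_mapD(2)[OF lin_map_dirac assms, of 1 "-1"] by simp

lemma d_diff:
  assumes "\<omega> \<in> cochains X" "\<eta> \<in> cochains X"
  shows "d (\<lambda>\<sigma>. \<omega> \<sigma> - \<eta> \<sigma>) = (\<lambda>\<sigma>. d \<omega> \<sigma> - d \<eta> \<sigma>)"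
  using d_lin[OF assms, of 1 "-1"] by simp

lemma l2_diff: "f \<in> l2 X m \<Longrightarrow> g \<in> l2 X m \<Longrightarrow> (\<lambda>\<sigma>. f \<sigma> - g \<sigma>) \<in> l2 X m"
  using l2_lin[of f g 1 "-1"] by simp

lemma ip_diff_left:
  assumes "f \<in> l2 X m" "g \<in> l2 X m" "h \<in> l2 X m"
  shows "ip (\<lambda>\<sigma>. f \<sigma> - g \<sigma>) h = ip f h - ip g h"
  using ip_lin_left[OF assms, of 1 "-1"] by simp

text \<open>Pythagoras, as \<open>d \<phi>\<close> and \<open>bdry \<phi>\<close> are
  orthogonal.\<close>

lemma nsq_d_le_dirac_fin:
  assumes "\<phi> \<in> fin_cochains X"
  shows "nsq (d \<phi>) \<le> nsq (dirac \<phi>)"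
  using nsq_lin[OF fin_d_l2[OF assms] fin_bdry_l2[OF assms], of 1 1]
    ip_d_bdry_fin[OF assms assms] nsq_nonneg[of "bdry \<phi>"]
  by (simp add: dirac_def)

text \<open>A form of Dirichlet approximation that asks for pointwise convergence in place of l2
  convergence. Pointwise limits are what the Fatou argument uses, and the notion passes to the
  errors \<open>\<phi> k - \<omega>\<close>.\<close>

definition approx :: "'v cochain \<Rightarrow> (nat \<Rightarrow> 'v cochain) \<Rightarrow> bool" where
  "approx \<omega> \<phi> \<longleftrightarrow> \<omega> \<in> l2 X m \<and> dirac \<omega> \<in> l2 X m \<and> (\<forall>n. \<phi> n \<in> fin_cochains X) \<and>
     (\<forall>\<sigma>\<in>X. (\<lambda>n. \<phi> n \<sigma>) \<longlonglongrightarrow> \<omega> \<sigma>) \<and> (\<lambda>n. nsq (dirac (\<lambda>\<sigma>. \<phi> n \<sigma> - \<omega> \<sigma>))) \<longlonglongrightarrow> 0"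

lemma form_D_approx:
  assumes "\<omega> \<in> dom (form_D X m (op_on (cochains1 X m) dirac))"
  obtains \<phi> where "approx \<omega> \<phi>"
proof -
  let ?q = "form_N X m (op_on (cochains1 X m) dirac)"
  from assms obtain \<phi> where N: "\<omega> \<in> dom ?q" and \<phi>: "\<And>n::nat. \<phi> n \<in> fin_cochains X"
    and lim: "(\<lambda>n. form_norm X m ?q (\<lambda>\<sigma>. \<phi> n \<sigma> - \<omega> \<sigma>)) \<longlonglongrightarrow> 0"
    by (auto simp: form_D_def)
  have \<omega>: "\<omega> \<in> l2 X m" "dirac \<omega> \<in> l2 X m" "\<omega> \<in> cochains1 X m"
    using N by (auto simp: dom_def form_N_op[OF lin_map_dirac] split: if_splits)
  define g where "g n = (\<lambda>\<sigma>. \<phi> n \<sigma> - \<omega> \<sigma>)" for n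
  have g: "g n \<in> l2 X m" for n
    unfolding g_def by (rule l2_diff[OF fin_l2[OF \<phi>] \<omega>(1)])
  have Dg: "dirac (g n) \<in> l2 X m" for n
    unfolding g_def dirac_diff[OF l2_cochains1[OF fin_l2[OF \<phi>]] \<omega>(3)]
    by (rule l2_diff[OF fin_dirac_l2[OF \<phi>] \<omega>(2)])
  have "form_norm X m ?q (g n) = sqrt (nsq (dirac (g n)) + nsq (g n))" for n
    by (simp add: form_norm_def form_N_op[OF lin_map_dirac] g Dg l2_cochains1 sqnorm_l2)
  then have "(\<lambda>n. sqrt (nsq (dirac (g n)) + nsq (g n))) \<longlonglongrightarrow> 0"
    using lim by (simp add: g_def)
  \<comment> \<open>Squaring removes the root; each of the two nonnegative summands is then squeezed
    to 0.\<close>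
  from tendsto_power[OF this, of 2]
  have sum0: "(\<lambda>n. nsq (dirac (g n)) + nsq (g n)) \<longlonglongrightarrow> 0"
    by (simp add: nsq_nonneg)
  have D0: "(\<lambda>n. nsq (dirac (g n))) \<longlonglongrightarrow> 0"
    by (rule tendsto_sandwich[OF _ _ tendsto_const sum0]) (simp_all add: nsq_nonneg)
  have "(\<lambda>n. nsq (g n)) \<longlonglongrightarrow> 0"
    by (rule tendsto_sandwich[OF _ _ tendsto_const sum0]) (simp_all add: nsq_nonneg)
  then have "(\<lambda>n. g n \<sigma>) \<longlonglongrightarrow> 0" if "\<sigma> \<in> X" for \<sigma>
    using nsq_tendsto_zero_pointwise[of g \<sigma>] g that by blast
  then have "\<forall>\<sigma>\<in>X. (\<lambda>n. \<phi> n \<sigma>) \<longlonglongrightarrow> \<omega> \<sigma>"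
    unfolding g_def by (simp add: LIM_zero_iff)
  then have "approx \<omega> \<phi>" using \<omega> \<phi> D0 by (simp add: approx_def g_def)
  then show ?thesis by (rule that)
qed

text \<open>Fatou along \<open>d (\<phi> n)\<close>, which converges pointwise because each value is
  a finite sum over facets. The factor 2 comes from \<open>nsq_lin_le\<close> and is harmless, since
  only continuity of the coboundary is wanted.\<close>

lemma approx_nsq_d_le:
  assumes "approx \<omega> \<phi>"
  shows "d \<omega> \<in> l2 X m \<and> nsq (d \<omega>) \<le> 2 * nsq (dirac \<omega>)"
proof (rule l2_Fatou)
  have \<omega>: "\<omega> \<in> l2 X m" "dirac \<omega> \<in> l2 X m" and \<phi>: "\<And>n. \<phi> n \<in> fin_cochains X"
    and lim: "\<And>\<sigma>. \<sigma> \<in> X \<Longrightarrow> (\<lambda>n. \<phi> n \<sigma>) \<longlonglongrightarrow> \<omega> \<sigma>"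
    and D0: "(\<lambda>n. nsq (dirac (\<lambda>\<sigma>. \<phi> n \<sigma> - \<omega> \<sigma>))) \<longlonglongrightarrow> 0"
    using assms by (auto simp: approx_def)
  show "d (\<phi> n) \<in> l2 X m" for n using \<phi> by (rule fin_d_l2)
  show "d \<omega> \<in> cochains X" using \<omega> by (intro d_cochains l2_cochains)
  show "(\<lambda>n. d (\<phi> n) \<sigma>) \<longlonglongrightarrow> d \<omega> \<sigma>" if "\<sigma> \<in> X" for \<sigma>
    unfolding d_apply[OF l2_cochains[OF fin_l2[OF \<phi>]] that] d_apply[OF l2_cochains[OF \<omega>(1)] that]
    using lim by (intro tendsto_sum tendsto_mult_right) auto
  show "nsq (d (\<phi> n)) \<le> 2 * nsq (dirac \<omega>) + 2 * nsq (dirac (\<lambda>\<sigma>. \<phi> n \<sigma> - \<omega> \<sigma>))" for n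
  proof -
    have eq: "dirac (\<lambda>\<sigma>. \<phi> n \<sigma> - \<omega> \<sigma>) = (\<lambda>\<sigma>. dirac (\<phi> n) \<sigma> - dirac \<omega> \<sigma>)"
      by (rule dirac_diff[OF l2_cochains1[OF fin_l2[OF \<phi>]] l2_cochains1[OF \<omega>(1)]])
    have "nsq (\<lambda>\<sigma>. dirac \<omega> \<sigma> + (dirac (\<phi> n) \<sigma> - dirac \<omega> \<sigma>))
        \<le> 2 * nsq (dirac \<omega>) + 2 * nsq (\<lambda>\<sigma>. dirac (\<phi> n) \<sigma> - dirac \<omega> \<sigma>)"
      by (rule nsq_lin_le[OF \<omega>(2) l2_diff[OF fin_dirac_l2[OF \<phi>] \<omega>(2)]])
    then show ?thesis using nsq_d_le_dirac_fin[OF \<phi>, of n] by (simp add: eq)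
  qed
  show "(\<lambda>n. 2 * nsq (dirac \<omega>) + 2 * nsq (dirac (\<lambda>\<sigma>. \<phi> n \<sigma> - \<omega> \<sigma>))) \<longlonglongrightarrow> 2 * nsq (dirac \<omega>)"
    using tendsto_add[OF tendsto_const tendsto_mult_right_zero[OF D0, of 2],
        of "2 * nsq (dirac \<omega>)"] by simp
qed

text \<open>Makes the preceding bound applicable to the errors \<open>\<phi> k - \<omega>\<close>.
  For fixed \<open>k\<close> the new error is \<open>\<omega> - \<phi> n\<close>, and its sign does
  not affect the norm.\<close>

lemma approx_diff:
  assumes "approx \<omega> \<phi>"
  shows "approx (\<lambda>\<sigma>. \<phi> k \<sigma> - \<omega> \<sigma>) (\<lambda>n \<sigma>. \<phi> k \<sigma> - \<phi> n \<sigma>)"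
proof -
  have \<omega>: "\<omega> \<in> l2 X m" "dirac \<omega> \<in> l2 X m" and \<phi>: "\<And>n. \<phi> n \<in> fin_cochains X"
    and lim: "\<And>\<sigma>. \<sigma> \<in> X \<Longrightarrow> (\<lambda>n. \<phi> n \<sigma>) \<longlonglongrightarrow> \<omega> \<sigma>"
    and D0: "(\<lambda>n. nsq (dirac (\<lambda>\<sigma>. \<phi> n \<sigma> - \<omega> \<sigma>))) \<longlonglongrightarrow> 0"
    using assms by (auto simp: approx_def)
  have c1: "\<omega> \<in> cochains1 X m" "\<phi> n \<in> cochains1 X m" for n
    using \<omega> \<phi> by (auto intro: l2_cochains1 fin_l2)
  have "dirac (\<lambda>\<sigma>. \<phi> k \<sigma> - \<omega> \<sigma>) \<in> l2 X m"
    unfolding dirac_diff[OF c1(2,1)] by (rule l2_diff[OF fin_dirac_l2[OF \<phi>] \<omega>(2)])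
  moreover have "(\<lambda>\<sigma>. \<phi> k \<sigma> - \<omega> \<sigma>) \<in> l2 X m" by (rule l2_diff[OF fin_l2[OF \<phi>] \<omega>(1)])
  moreover have "(\<lambda>\<sigma>. \<phi> k \<sigma> - \<phi> n \<sigma>) \<in> fin_cochains X" for n
    using fin_cochains_lin[OF \<phi> \<phi>, of 1 k "-1" n] by simp
  moreover have "(\<lambda>n. \<phi> k \<sigma> - \<phi> n \<sigma>) \<longlonglongrightarrow> \<phi> k \<sigma> - \<omega> \<sigma>" if "\<sigma> \<in> X" for \<sigma>
    using lim[OF that] by (intro tendsto_diff tendsto_const)
  moreover have "nsq (dirac (\<lambda>\<sigma>. (\<phi> k \<sigma> - \<phi> n \<sigma>) - (\<phi> k \<sigma> - \<omega> \<sigma>)))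
      = nsq (dirac (\<lambda>\<sigma>. \<phi> n \<sigma> - \<omega> \<sigma>))" for n
    by (simp add: dirac_diff c1 nsq_minus[of "dirac \<omega>"])
  ultimately show ?thesis using D0 by (simp add: approx_def)
qed

text \<open>For \<open>\<phi> n\<close> the pairings of \<open>dirac\<close> and \<open>d\<close>
  with \<open>d (indicator {\<rho>})\<close> agree by orthogonality. Both pairings are continuous
  along the approximation, so they agree for \<open>\<omega>\<close>.\<close>

lemma approx_bdry_dirac:
  assumes "approx \<omega> \<phi>"
  shows "bdry (dirac \<omega>) = bdry (d \<omega>)"
proof (rule cochains_eqI)
  have \<omega>: "\<omega> \<in> l2 X m" "dirac \<omega> \<in> l2 X m" and \<phi>: "\<And>n. \<phi> n \<in> fin_cochains X"
    and D0: "(\<lambda>n. nsq (dirac (\<lambda>\<sigma>. \<phi> n \<sigma> - \<omega> \<sigma>))) \<longlonglongrightarrow> 0"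
    using assms by (auto simp: approx_def)
  have d\<omega>: "d \<omega> \<in> l2 X m" using approx_nsq_d_le[OF assms] by simp
  define g where "g n = (\<lambda>\<sigma>. \<phi> n \<sigma> - \<omega> \<sigma>)" for n
  have approx_g: "approx (g n) (\<lambda>k \<sigma>. \<phi> n \<sigma> - \<phi> k \<sigma>)" for n
    unfolding g_def using assms by (rule approx_diff)
  have g: "g n \<in> l2 X m" "dirac (g n) \<in> l2 X m" "d (g n) \<in> l2 X m" for n
    using approx_g[of n] approx_nsq_d_le[OF approx_g[of n]] by (auto simp: approx_def)
  have Dg0: "(\<lambda>n. nsq (dirac (g n))) \<longlonglongrightarrow> 0" using D0 by (simp add: g_def)
  \<comment> \<open>Convergence of \<open>d (\<phi> n)\<close> to \<open>d \<omega>\<close> in norm: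
    the bound by \<open>dirac\<close> is applied to each error \<open>g n\<close>.\<close>
  have dg0: "(\<lambda>n. nsq (d (g n))) \<longlonglongrightarrow> 0"
  proof (rule tendsto_sandwich[where f = "\<lambda>_. 0"])
    show "(\<lambda>n. 2 * nsq (dirac (g n))) \<longlonglongrightarrow> 0" using tendsto_mult_right_zero[OF Dg0] .
  qed (use approx_nsq_d_le[OF approx_g] in \<open>simp_all add: nsq_nonneg\<close>)
  fix \<rho> assume \<rho>: "\<rho> \<in> X"
  let ?e = "d (indicator {\<rho>})"
  note e = d_indicator_l2[OF \<rho>]
  have "ip (dirac (\<phi> n)) ?e = ip (d (\<phi> n)) ?e" for n
    using ip_lin_left[OF fin_d_l2[OF \<phi>] fin_bdry_l2[OF \<phi>] e, of 1 n 1 n]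
      ip_d_bdry_fin[OF \<phi> indicator_fin[OF \<rho>]]
    by (simp add: dirac_def ip_commute)
  moreover have "ip (dirac (g n)) ?e = ip (dirac (\<phi> n)) ?e - ip (dirac \<omega>) ?e" for n
    unfolding g_def using \<phi> \<omega> e
    by (subst dirac_diff) (auto intro!: ip_diff_left l2_cochains1 fin_l2 fin_dirac_l2)
  moreover have "ip (d (g n)) ?e = ip (d (\<phi> n)) ?e - ip (d \<omega>) ?e" for n
    unfolding g_def using \<phi> \<omega> e d\<omega>
    by (subst d_diff) (auto intro!: ip_diff_left l2_cochains fin_l2 fin_d_l2)
  \<comment> \<open>The right side does not depend on \<open>n\<close> while the left side tends to
    0, so it vanishes.\<close>
  ultimately have "ip (d (g n)) ?e - ip (dirac (g n)) ?e = ip (dirac \<omega>) ?e - ip (d \<omega>) ?e" for n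
    by simp
  moreover have "(\<lambda>n. ip (d (g n)) ?e - ip (dirac (g n)) ?e) \<longlonglongrightarrow> 0 - 0"
    using g e dg0 Dg0 by (intro tendsto_diff ip_tendsto_zero)
  ultimately have "ip (dirac \<omega>) ?e = ip (d \<omega>) ?e" by (simp add: LIMSEQ_const_iff)
  then show "m \<rho> * bdry (dirac \<omega>) \<rho> = m \<rho> * bdry (d \<omega>) \<rho>"
    using \<rho> by (simp add: ip_d_indicator)
qed (rule bdry_cochains)+

section \<open>Strong local summability: the boundary squares to zero\<close>

text \<open>An intermediate face adds one vertex of \<open>\<sigma> - \<rho>\<close> to
  \<open>\<rho>\<close>, and if any such face exists this difference has at most two
  vertices.\<close>

lemma card_between_le:
  assumes "\<rho> \<in> X" "\<sigma> \<in> X"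
  shows "finite {\<tau> \<in> cofaces X \<rho>. \<sigma> \<in> cofaces X \<tau>}"
    and "card {\<tau> \<in> cofaces X \<rho>. \<sigma> \<in> cofaces X \<tau>} \<le> 2"
proof -
  let ?B = "{\<tau> \<in> cofaces X \<rho>. \<sigma> \<in> cofaces X \<tau>}"
  have fin\<sigma>: "finite \<sigma>" using assms(2) by (rule face_finite)
  have sub: "?B \<subseteq> (\<lambda>x. insert x \<rho>) ` (\<sigma> - \<rho>)"
  proof
    fix \<tau> assume "\<tau> \<in> ?B"
    then have *: "\<rho> \<subseteq> \<tau>" "card (\<tau> - \<rho>) = 1" "\<tau> \<subseteq> \<sigma>"
      by (auto simp: cofaces_def covered_by_def)
    then obtain x where "\<tau> - \<rho> = {x}" by (auto simp: card_1_singleton_iff)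
    then have "\<tau> = insert x \<rho>" "x \<in> \<sigma> - \<rho>" using * by auto
    then show "\<tau> \<in> (\<lambda>x. insert x \<rho>) ` (\<sigma> - \<rho>)" by blast
  qed
  then show "finite ?B" by (rule finite_subset) (use fin\<sigma> in simp)
  show "card ?B \<le> 2"
  proof (cases "?B = {}")
    case False
    then obtain \<tau> where "\<rho> \<subseteq> \<tau>" "card (\<tau> - \<rho>) = 1" "\<tau> \<subseteq> \<sigma>" "card (\<sigma> - \<tau>) = 1"
      by (auto simp: cofaces_def covered_by_def)
    moreover have "card (\<sigma> - \<rho>) \<le> card ((\<sigma> - \<tau>) \<union> (\<tau> - \<rho>))"
      using fin\<sigma> \<open>\<tau> \<subseteq> \<sigma>\<close> by (intro card_mono finite_subset[OF _ fin\<sigma>]) auto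
    moreover have "card ((\<sigma> - \<tau>) \<union> (\<tau> - \<rho>)) \<le> card (\<sigma> - \<tau>) + card (\<tau> - \<rho>)"
      by (rule card_Un_le)
    ultimately have "card (\<sigma> - \<rho>) \<le> 2" by simp
    then show ?thesis using surj_card_le[OF _ sub] fin\<sigma> by simp
  qed (simp only: card.empty)
qed

text \<open>The sum is the value at \<open>\<sigma>\<close> of the twofold coboundary of the
  indicator of \<open>\<rho>\<close>.\<close>

lemma theta_theta_sum:
  assumes "\<rho> \<in> X" "\<sigma> \<in> X"
  shows "(\<Sum>\<tau>\<in>{\<tau> \<in> cofaces X \<rho>. \<sigma> \<in> cofaces X \<tau>}. theta d \<rho> \<tau> * theta d \<tau> \<sigma>) = 0"
proof -
  have "(\<Sum>\<tau>\<in>{\<tau> \<in> cofaces X \<rho>. \<sigma> \<in> cofaces X \<tau>}. theta d \<rho> \<tau> * theta d \<tau> \<sigma>)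
      = (\<Sum>\<tau> | \<tau> \<in> X \<and> \<tau> \<prec>\<^sub>1 \<sigma>. d (indicator {\<rho>}) \<tau> * theta d \<tau> \<sigma>)"
    using assms facets_finite[OF assms(2)]
    by (intro sum.mono_neutral_cong_left) (auto simp: d_indicator cofaces_def)
  also have "\<dots> = d (d (indicator {\<rho>})) \<sigma>"
    using assms by (simp add: d_apply d_cochains indicator_cochains)
  also have "\<dots> = 0" using assms by (simp add: d_d indicator_cochains)
  finally show ?thesis .
qed

text \<open>Again \<open>|x| <= 1 + x^2\<close>. The constant part is strong local summability; the
  square part meets each \<open>\<sigma>\<close> at most twice. This is the absolute convergence
  behind Fubini.\<close>

lemma strong_pairs_summable:
  assumes "strongly_locally_summable X m" "\<omega> \<in> l2 X m" "\<rho> \<in> X"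
  shows "(\<lambda>(\<tau>, \<sigma>). m \<sigma> * \<bar>\<omega> \<sigma>\<bar>) summable_on (SIGMA \<tau>:cofaces X \<rho>. cofaces X \<tau>)"
    (is "_ summable_on ?P")
proof -
  let ?B = "\<lambda>\<sigma>. {\<tau> \<in> cofaces X \<rho>. \<sigma> \<in> cofaces X \<tau>}"
  have "(\<lambda>(\<tau>, \<sigma>). m \<sigma>) summable_on ?P"
  proof (rule summable_on_SigmaI)
    show "(\<lambda>\<tau>. \<Sum>\<^sub>\<infinity>\<sigma>\<in>cofaces X \<tau>. m \<sigma>) summable_on cofaces X \<rho>"
      using assms by (simp add: strongly_locally_summable_def)
    fix \<tau> assume "\<tau> \<in> cofaces X \<rho>"
    then have "m summable_on cofaces X \<tau>"
      using loc_summable cofaces_subset by (auto simp: locally_summable_def)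
    then show "((\<lambda>\<sigma>. case (\<tau>, \<sigma>) of (\<tau>, \<sigma>) \<Rightarrow> m \<sigma>) has_sum (\<Sum>\<^sub>\<infinity>\<sigma>\<in>cofaces X \<tau>. m \<sigma>)) (cofaces X \<tau>)"
      by (simp add: has_sum_infsum)
  qed (use m_nonneg cofaces_subset in auto)
  moreover have "(\<lambda>(\<tau>, \<sigma>). m \<sigma> * (\<omega> \<sigma>)\<^sup>2) summable_on ?P"
  proof -
    \<comment> \<open>With \<open>\<sigma>\<close> outermost the inner sums are finite and the outer
      one is at most twice the squared norm of \<open>\<omega>\<close>; swapping the pairs then
      gives the claim.\<close>
    have "(\<lambda>(\<sigma>, \<tau>). m \<sigma> * (\<omega> \<sigma>)\<^sup>2) summable_on (SIGMA \<sigma>:X. ?B \<sigma>)"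
    proof (rule summable_on_SigmaI)
      fix \<sigma> assume "\<sigma> \<in> X"
      then show "((\<lambda>\<tau>. case (\<sigma>, \<tau>) of (\<sigma>, \<tau>) \<Rightarrow> m \<sigma> * (\<omega> \<sigma>)\<^sup>2) has_sum
          (\<Sum>\<tau>\<in>?B \<sigma>. m \<sigma> * (\<omega> \<sigma>)\<^sup>2)) (?B \<sigma>)"
        using card_between_le(1)[OF assms(3)] by (auto intro: has_sum_finite)
    next
      show "(\<lambda>\<sigma>. \<Sum>\<tau>\<in>?B \<sigma>. m \<sigma> * (\<omega> \<sigma>)\<^sup>2) summable_on X"
      proof (rule summable_on_real_comparison)
        show "(\<lambda>\<sigma>. 2 * (m \<sigma> * (\<omega> \<sigma>)\<^sup>2)) summable_on X"
          using assms(2) by (intro summable_on_cmult_right) (simp add: l2_iff)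
        fix \<sigma> assume \<sigma>: "\<sigma> \<in> X"
        have "real (card (?B \<sigma>)) * (m \<sigma> * (\<omega> \<sigma>)\<^sup>2) \<le> 2 * (m \<sigma> * (\<omega> \<sigma>)\<^sup>2)"
          using card_between_le(2)[OF assms(3) \<sigma>] m_nonneg[OF \<sigma>] by (intro mult_right_mono) auto
        then show "\<bar>\<Sum>\<tau>\<in>?B \<sigma>. m \<sigma> * (\<omega> \<sigma>)\<^sup>2\<bar> \<le> 2 * (m \<sigma> * (\<omega> \<sigma>)\<^sup>2)"
          using m_nonneg[OF \<sigma>] by (simp add: abs_mult)
      qed
    qed (use m_nonneg in auto)
    then show ?thesis
      by (rule summable_on_reindex_bij_witness[where i = prod.swap and j = prod.swap, THEN iffD1, rotated -1])
         (use cofaces_subset in \<open>auto simp: cofaces_def\<close>)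
  qed
  ultimately have "(\<lambda>p. (case p of (\<tau>, \<sigma>) \<Rightarrow> m \<sigma>) + (case p of (\<tau>, \<sigma>) \<Rightarrow> m \<sigma> * (\<omega> \<sigma>)\<^sup>2)) summable_on ?P"
    by (rule summable_on_add)
  then show ?thesis
  proof (rule summable_on_real_comparison)
    fix p assume "p \<in> ?P"
    then obtain \<tau> \<sigma> where p: "p = (\<tau>, \<sigma>)" "\<sigma> \<in> X" using cofaces_subset by auto
    have "\<bar>\<omega> \<sigma>\<bar> \<le> 1 + (\<omega> \<sigma>)\<^sup>2"
      using sum_squares_bound[of "\<bar>\<omega> \<sigma>\<bar>" 1] by simp
    then have "m \<sigma> * \<bar>\<omega> \<sigma>\<bar> \<le> m \<sigma> * (1 + (\<omega> \<sigma>)\<^sup>2)" using m_nonneg[OF p(2)] by (intro mult_left_mono)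
    then show "\<bar>case p of (\<tau>, \<sigma>) \<Rightarrow> m \<sigma> * \<bar>\<omega> \<sigma>\<bar>\<bar>
        \<le> (case p of (\<tau>, \<sigma>) \<Rightarrow> m \<sigma>) + (case p of (\<tau>, \<sigma>) \<Rightarrow> m \<sigma> * (\<omega> \<sigma>)\<^sup>2)"
      using m_nonneg[OF p(2)] by (simp add: p abs_mult algebra_simps)
  qed
qed

text \<open>The factor \<open>m \<tau>\<close> cancels the denominator of the boundary, so each term
  is at most the inner sum over the summable pairs.\<close>

lemma strong_bdry_cochains1:
  assumes "strongly_locally_summable X m" "\<omega> \<in> l2 X m"
  shows "bdry \<omega> \<in> cochains1 X m"
proof -
  have "(\<lambda>\<tau>. m \<tau> * \<bar>bdry \<omega> \<tau>\<bar>) summable_on cofaces X \<rho>" if "\<rho> \<in> X" for \<rho>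
  proof (rule summable_on_real_comparison)
    show "(\<lambda>\<tau>. \<Sum>\<^sub>\<infinity>\<sigma>\<in>cofaces X \<tau>. m \<sigma> * \<bar>\<omega> \<sigma>\<bar>) summable_on cofaces X \<rho>"
      using strong_pairs_summable[OF assms that] by (rule summable_on_Sigma_banach)
    fix \<tau> assume "\<tau> \<in> cofaces X \<rho>"
    then have \<tau>: "\<tau> \<in> X" using cofaces_subset by auto
    have "\<bar>\<Sum>\<^sub>\<infinity>\<sigma>\<in>cofaces X \<tau>. m \<sigma> * \<omega> \<sigma> * theta d \<tau> \<sigma>\<bar>
        \<le> (\<Sum>\<^sub>\<infinity>\<sigma>\<in>cofaces X \<tau>. norm (m \<sigma> * \<omega> \<sigma> * theta d \<tau> \<sigma>))"
      unfolding real_norm_def[symmetric]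
      by (rule norm_infsum_bound)
         (use cochains1_summable[OF l2_cochains1[OF assms(2)] \<tau>] in
           \<open>simp add: summable_on_iff_abs_summable_on_real[symmetric] del: real_norm_def\<close>)
    also have "\<dots> = (\<Sum>\<^sub>\<infinity>\<sigma>\<in>cofaces X \<tau>. m \<sigma> * \<bar>\<omega> \<sigma>\<bar>)"
    proof (rule infsum_cong)
      fix \<sigma> assume \<sigma>: "\<sigma> \<in> cofaces X \<tau>"
      then have "\<sigma> \<in> X" using cofaces_subset by auto
      then show "norm (m \<sigma> * \<omega> \<sigma> * theta d \<tau> \<sigma>) = m \<sigma> * \<bar>\<omega> \<sigma>\<bar>"
        using abs_theta[OF \<tau> \<sigma>] m_nonneg by (simp add: abs_mult)
    qed
    finally show "\<bar>m \<tau> * \<bar>bdry \<omega> \<tau>\<bar>\<bar> \<le> (\<Sum>\<^sub>\<infinity>\<sigma>\<in>cofaces X \<tau>. m \<sigma> * \<bar>\<omega> \<sigma>\<bar>)"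
      using \<tau> m_pos[OF \<tau>] by (simp add: bdry_def abs_mult)
  qed
  then show ?thesis by (simp add: cochains1_def bdry_cochains)
qed

text \<open>Fubini makes the sum over \<open>\<sigma>\<close> the outer one; for each
  \<open>\<sigma>\<close> the signs over the intermediate faces cancel by
  \<open>theta_theta_sum\<close>.\<close>

lemma strong_bdry_bdry:
  assumes "strongly_locally_summable X m" "\<omega> \<in> l2 X m"
  shows "bdry (bdry \<omega>) = (\<lambda>\<sigma>. 0)"
proof -
  have "(\<Sum>\<^sub>\<infinity>\<tau>\<in>cofaces X \<rho>. m \<tau> * bdry \<omega> \<tau> * theta d \<rho> \<tau>) = 0" if \<rho>: "\<rho> \<in> X" for \<rho>
  proof -
    let ?P = "SIGMA \<tau>:cofaces X \<rho>. cofaces X \<tau>"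
    let ?B = "\<lambda>\<sigma>. {\<tau> \<in> cofaces X \<rho>. \<sigma> \<in> cofaces X \<tau>}"
    let ?F = "\<lambda>\<tau> \<sigma>. theta d \<rho> \<tau> * (m \<sigma> * \<omega> \<sigma> * theta d \<tau> \<sigma>)"
    have P: "(\<lambda>(\<tau>, \<sigma>). ?F \<tau> \<sigma>) summable_on ?P"
    proof (rule summable_on_real_comparison[OF strong_pairs_summable[OF assms \<rho>]])
      fix p assume "p \<in> ?P"
      then obtain \<tau> \<sigma> where p: "p = (\<tau>, \<sigma>)" "\<tau> \<in> cofaces X \<rho>" "\<sigma> \<in> cofaces X \<tau>" by auto
      then have X: "\<tau> \<in> X" "\<sigma> \<in> X" using cofaces_subset by auto
      show "\<bar>case p of (\<tau>, \<sigma>) \<Rightarrow> ?F \<tau> \<sigma>\<bar> \<le> (case p of (\<tau>, \<sigma>) \<Rightarrow> m \<sigma> * \<bar>\<omega> \<sigma>\<bar>)"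
        using m_nonneg[OF X(2)] abs_theta[OF \<rho> p(2)] abs_theta[OF X(1) p(3)]
        by (simp add: p(1) abs_mult)
    qed
    have swap: "bij_betw prod.swap (SIGMA \<sigma>:X. ?B \<sigma>) ?P"
      by (rule bij_betw_byWitness[where f' = prod.swap])
         (use cofaces_subset in \<open>auto simp: cofaces_def\<close>)
    have Q: "(\<lambda>(\<sigma>, \<tau>). ?F \<tau> \<sigma>) summable_on (SIGMA \<sigma>:X. ?B \<sigma>)"
      using summable_on_reindex_bij_betw[OF swap, of "\<lambda>(\<tau>, \<sigma>). ?F \<tau> \<sigma>"] P
      by (simp add: case_prod_unfold)
    have "(\<Sum>\<^sub>\<infinity>\<tau>\<in>cofaces X \<rho>. m \<tau> * bdry \<omega> \<tau> * theta d \<rho> \<tau>)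
        = (\<Sum>\<^sub>\<infinity>\<tau>\<in>cofaces X \<rho>. \<Sum>\<^sub>\<infinity>\<sigma>\<in>cofaces X \<tau>. ?F \<tau> \<sigma>)"
    proof (rule infsum_cong)
      fix \<tau> assume "\<tau> \<in> cofaces X \<rho>"
      then have \<tau>: "\<tau> \<in> X" using cofaces_subset by auto
      then show "m \<tau> * bdry \<omega> \<tau> * theta d \<rho> \<tau> = (\<Sum>\<^sub>\<infinity>\<sigma>\<in>cofaces X \<tau>. ?F \<tau> \<sigma>)"
        using m_pos[OF \<tau>] by (simp add: bdry_def infsum_cmult_right')
    qed
    also have "\<dots> = (\<Sum>\<^sub>\<infinity>(\<tau>, \<sigma>)\<in>?P. ?F \<tau> \<sigma>)"
      using P by (rule infsum_Sigma'_banach)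
    also have "\<dots> = (\<Sum>\<^sub>\<infinity>(\<sigma>, \<tau>)\<in>(SIGMA \<sigma>:X. ?B \<sigma>). ?F \<tau> \<sigma>)"
      using infsum_reindex_bij_betw[OF swap, of "\<lambda>(\<tau>, \<sigma>). ?F \<tau> \<sigma>"]
      by (simp add: case_prod_unfold)
    also have "\<dots> = (\<Sum>\<^sub>\<infinity>\<sigma>\<in>X. \<Sum>\<^sub>\<infinity>\<tau>\<in>?B \<sigma>. ?F \<tau> \<sigma>)"
      using infsum_Sigma'_banach[OF Q] by simp
    also have "\<dots> = (\<Sum>\<^sub>\<infinity>\<sigma>\<in>X. 0)"
    proof (rule infsum_cong)
      fix \<sigma> assume \<sigma>: "\<sigma> \<in> X"
      have "(\<Sum>\<^sub>\<infinity>\<tau>\<in>?B \<sigma>. ?F \<tau> \<sigma>) = (\<Sum>\<tau>\<in>?B \<sigma>. m \<sigma> * \<omega> \<sigma> * (theta d \<rho> \<tau> * theta d \<tau> \<sigma>))"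
        using card_between_le(1)[OF \<rho> \<sigma>] by (simp add: mult_ac)
      also have "\<dots> = 0"
        by (simp only: sum_distrib_left[symmetric] theta_theta_sum[OF \<rho> \<sigma>] mult_zero_right)
      finally show "(\<Sum>\<^sub>\<infinity>\<tau>\<in>?B \<sigma>. ?F \<tau> \<sigma>) = 0" .
    qed
    finally show ?thesis by simp
  qed
  then show ?thesis unfolding bdry_def[of "bdry \<omega>"] by auto
qed

section \<open>Assembling the splitting and the final statement\<close>

text \<open>Writing \<open>d \<omega>\<close> as \<open>dirac \<omega> - bdry \<omega>\<close> puts
  it in the domain of the boundary, since both terms are there; applying the boundary kills the
  second term.\<close>

lemma hodge_splitting_strong:
  assumes "strongly_locally_summable X m" "\<omega> \<in> l2 X m" "dirac \<omega> \<in> l2 X m"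
  shows "d \<omega> \<in> cochains1 X m \<and> bdry (dirac \<omega>) = bdry (d \<omega>)"
proof -
  note b = strong_bdry_cochains1[OF assms(1,2)] and f = l2_cochains1[OF assms(3)]
  have "(\<lambda>\<sigma>. 1 * dirac \<omega> \<sigma> + -1 * bdry \<omega> \<sigma>) \<in> cochains1 X m"
    using f b by (rule cochains1_lin)
  moreover have eq: "(\<lambda>\<sigma>. 1 * dirac \<omega> \<sigma> + -1 * bdry \<omega> \<sigma>) = d \<omega>"
    by (simp add: dirac_def)
  ultimately show ?thesis
    using bdry_lin[OF f b, of 1 "-1"] unfolding eq strong_bdry_bdry[OF assms(1,2)] by simp
qed

lemma hodge_splitting_Dirichlet:
  assumes "\<omega> \<in> dom (laplacian_D X m (coboundary_op X d \<oplus>\<^sub>m boundary_op X m d))"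
  shows "d \<omega> \<in> cochains1 X m \<and> bdry (dirac \<omega>) = bdry (d \<omega>)"
proof -
  have "\<omega> \<in> dom (form_D X m (op_on (cochains1 X m) dirac))"
    using assms unfolding laplacian_D_def dirac_op_eq
    by (auto simp: form_operator_def restrict_map_def split: if_splits)
  then obtain \<phi> where "approx \<omega> \<phi>" by (rule form_D_approx)
  then show ?thesis using approx_nsq_d_le approx_bdry_dirac l2_cochains1 by blast
qed

lemma hodge_splitting:
  assumes "laplacian X m (coboundary_op X d \<oplus>\<^sub>m boundary_op X m d) L" "\<omega> \<in> dom L"
    and "L = laplacian_D X m (coboundary_op X d \<oplus>\<^sub>m boundary_op X m d)
      \<or> strongly_locally_summable X m"
  shows "L \<omega> = Some (\<lambda>\<sigma>. bdry (d \<omega>) \<sigma> + d (bdry \<omega>) \<sigma>)" "d \<omega> \<in> cochains1 X m"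
proof -
  have *: "d \<omega> \<in> cochains1 X m \<and> bdry (dirac \<omega>) = bdry (d \<omega>)"
    using assms(2,3) hodge_splitting_Dirichlet hodge_splitting_strong
      hodge_laplacian(3,4)[OF assms(1,2)] by blast
  then show "d \<omega> \<in> cochains1 X m" ..
  show "L \<omega> = Some (\<lambda>\<sigma>. bdry (d \<omega>) \<sigma> + d (bdry \<omega>) \<sigma>)"
    using dirac_dirac hodge_laplacian(1,2)[OF assms(1,2)] * by simp
qed

end

text \<open>The values compared are options, so agreement with a defined value of \<open>f\<close>
  also shows that \<open>g\<close> is defined there.\<close>

lemma map_agree_on_dom:
  assumes "\<And>x. x \<in> dom f \<Longrightarrow> g x = f x"
  shows "dom f \<subseteq> dom g \<and> (\<forall>x\<in>dom f. f x = g x)"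
  using assms by (metis domIff subsetI)

theorem theorem3p4:
  fixes V :: "'v set" and S X :: "'v set set" and m :: "'v set \<Rightarrow> real"
    and d :: "'v cochain \<Rightarrow> 'v cochain"
    and del bd Lplus Lminus LH :: "'v cochain \<rightharpoonup> 'v cochain"
  assumes "simplicial_complex V S"
    and "weight S m"
    and "X = active_faces S m"
    and "locally_summable X m"
    and "coboundary_map X d"
    and "del = coboundary_op X d"
    and "bd = boundary_op X m d"
    and "laplacian X m del Lplus"
    and "laplacian X m bd Lminus"
    and "laplacian X m (del \<oplus>\<^sub>m bd) LH"
  shows "dom Lplus \<subseteq> dom (bd \<circ>\<^sub>m del) \<and> (\<forall>\<omega>\<in>dom Lplus. Lplus \<omega> = (bd \<circ>\<^sub>m del) \<omega>) \<and>
         dom Lminus \<subseteq> dom (del \<circ>\<^sub>m bd) \<and> (\<forall>\<omega>\<in>dom Lminus. Lminus \<omega> = (del \<circ>\<^sub>m bd) \<omega>) \<and>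
         dom LH \<subseteq> dom ((del \<oplus>\<^sub>m bd) \<circ>\<^sub>m (del \<oplus>\<^sub>m bd)) \<and>
         (\<forall>\<omega>\<in>dom LH. LH \<omega> = ((del \<oplus>\<^sub>m bd) \<circ>\<^sub>m (del \<oplus>\<^sub>m bd)) \<omega>) \<and>
         (LH = laplacian_D X m (del \<oplus>\<^sub>m bd) \<or> strongly_locally_summable X m \<longrightarrow>
            dom LH \<subseteq> dom ((bd \<circ>\<^sub>m del) \<oplus>\<^sub>m (del \<circ>\<^sub>m bd)) \<and>
            (\<forall>\<omega>\<in>dom LH. LH \<omega> = ((bd \<circ>\<^sub>m del) \<oplus>\<^sub>m (del \<circ>\<^sub>m bd)) \<omega>))"
proof -
  interpret weighted_complex X m d
  proof
    show "finite \<tau>" "0 < m \<tau>" if "\<tau> \<in> X" for \<tau>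
      using assms(1-3) that
      by (auto simp: simplicial_complex_def weight_def active_faces_def split: if_splits)
  qed (fact assms)+
  note del = assms(6) and bd = assms(7)
  have plus: "(bd \<circ>\<^sub>m del) \<omega> = Lplus \<omega>" if "\<omega> \<in> dom Lplus" for \<omega>
    using upper_laplacian[of Lplus \<omega>] that assms(8) l2_cochains1
    by (simp add: del bd map_comp_def coboundary_op_eq boundary_op_eq op_on_def)
  have minus: "(del \<circ>\<^sub>m bd) \<omega> = Lminus \<omega>" if "\<omega> \<in> dom Lminus" for \<omega>
    using lower_laplacian[of Lminus \<omega>] that assms(9) bdry_cochains
    by (simp add: del bd map_comp_def coboundary_op_eq boundary_op_eq op_on_def)
  have H: "((del \<oplus>\<^sub>m bd) \<circ>\<^sub>m (del \<oplus>\<^sub>m bd)) \<omega> = LH \<omega>" if "\<omega> \<in> dom LH" for \<omega>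
    using hodge_laplacian[of LH \<omega>] that assms(10) l2_cochains1
    by (simp add: del bd map_comp_def dirac_op_eq op_on_def)
  have split: "((bd \<circ>\<^sub>m del) \<oplus>\<^sub>m (del \<circ>\<^sub>m bd)) \<omega> = LH \<omega>"
    if "\<omega> \<in> dom LH" "LH = laplacian_D X m (del \<oplus>\<^sub>m bd) \<or> strongly_locally_summable X m" for \<omega>
  proof -
    \<comment> \<open>The membership of \<open>d \<omega>\<close> in \<open>cochains1 X m\<close> is
      what makes the first composition defined at \<open>\<omega>\<close>.\<close>
    have LH: "LH \<omega> = Some (\<lambda>\<sigma>. bdry (d \<omega>) \<sigma> + d (bdry \<omega>) \<sigma>)" "d \<omega> \<in> cochains1 X m"
      using hodge_splitting[of LH \<omega>] that assms(10) unfolding del bd by blast+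
    have "\<omega> \<in> cochains1 X m" using hodge_laplacian(2)[of LH \<omega>] that assms(10) by (simp add: del bd)
    then have "(bd \<circ>\<^sub>m del) \<omega> = Some (bdry (d \<omega>))" "(del \<circ>\<^sub>m bd) \<omega> = Some (d (bdry \<omega>))"
      using LH(2) bdry_cochains cochains1_cochains
      by (simp_all add: del bd map_comp_def coboundary_op_eq boundary_op_eq op_on_def)
    then show ?thesis by (simp add: op_plus_def dom_def LH(1))
  qed
  note 1 = map_agree_on_dom[of Lplus, OF plus] and 2 = map_agree_on_dom[of Lminus, OF minus]
    and 3 = map_agree_on_dom[of LH, OF H]
  have 4: "LH = laplacian_D X m (del \<oplus>\<^sub>m bd) \<or> strongly_locally_summable X m \<longrightarrow>
      dom LH \<subseteq> dom ((bd \<circ>\<^sub>m del) \<oplus>\<^sub>m (del \<circ>\<^sub>m bd)) \<and>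
      (\<forall>\<omega>\<in>dom LH. LH \<omega> = ((bd \<circ>\<^sub>m del) \<oplus>\<^sub>m (del \<circ>\<^sub>m bd)) \<omega>)"
    by (intro impI map_agree_on_dom split)
  show ?thesis
    by (intro conjI 1[THEN conjunct1] 1[THEN conjunct2] 2[THEN conjunct1] 2[THEN conjunct2]
      3[THEN conjunct1] 3[THEN conjunct2] 4)
qed

end
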